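(* Let $G$ be a Lie group and let $\nabla$ be the linear connection on $G$ determined by $\nabla_XY=\frac12[X,Y]$ for all left-invariant vector fields $X,Y$. Then $\nabla_XY=\frac12[X,Y]$ also holds for all right-invariant vector fields $X,Y$, so that $\nabla$ may equally be defined using right-invariant vector fields; hence $\nabla$ is also right-invariant, and hence bi-invariant. Moreover $\nabla$ is symmetric, that is, its torsion is zero.
   Context: The connection $\nabla$ is defined by the formula on left-invariant vector fields and extended to arbitrary vector fields by linearity and the Leibniz rule; it is left-invariant by construction. A connection on $G$ is left- (respectively right-) invariant if all left (respectively right) translations are affine transformations of it, and bi-invariant if it is both. *)

theory Defs
  imports "HOL-Analysis.Analysis"
begin

section \<open>Smooth maps between finite-dimensional vector spaces\<close>

text \<open>
  The set \<open>S\<close> is always open and the domain finite-dimensional below, so that this is the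
  usual notion: all iterated directional derivatives exist and are differentiable.
\<close>

primrec Ck_on :: "nat \<Rightarrow> 'a set \<Rightarrow> ('a::real_normed_vector \<Rightarrow> 'b::real_normed_vector) \<Rightarrow> bool" where
  "Ck_on 0 S f \<longleftrightarrow> continuous_on S f"
| "Ck_on (Suc k) S f \<longleftrightarrow> (\<forall>x\<in>S. f differentiable (at x)) \<and>
     (\<forall>v. Ck_on k S (\<lambda>x. frechet_derivative f (at x) v))"

definition smooth_on :: "'a set \<Rightarrow> ('a::real_normed_vector \<Rightarrow> 'b::real_normed_vector) \<Rightarrow> bool" where
  "smooth_on S f \<longleftrightarrow> (\<forall>k. Ck_on k S f)"


section \<open>Smooth manifolds\<close>

text \<open>
  A chart \<open>(U, \<phi>)\<close> is given by its domain and a coordinate map, whose values outside \<open>U\<close> are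
  irrelevant; its inverse is \<open>inv_into U \<phi>\<close>.  The smooth structure is given by any (not
  necessarily maximal) atlas.

  The model space is an arbitrary finite-dimensional real Hilbert space.  The class
  \<open>euclidean_space\<close> is not used because it excludes dimension 0; completeness (class \<open>banach\<close>)
  is automatic in finite dimension.
\<close>

type_synonym ('m, 'e) atlas = "('m set \<times> ('m \<Rightarrow> 'e)) set"

definition chart :: "'m::topological_space set \<Rightarrow> ('m \<Rightarrow> 'e::real_normed_vector) \<Rightarrow> bool" where
  "chart U \<phi> \<longleftrightarrow> open U \<and> open (\<phi> ` U) \<and> homeomorphism U (\<phi> ` U) \<phi> (inv_into U \<phi>)"

definition smooth_manifold ::
    "('m::{t2_space,second_countable_topology}, 'e::{real_inner,banach}) atlas \<Rightarrow> bool" where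
  "smooth_manifold A \<longleftrightarrow>
     (\<exists>B::'e set. finite B \<and> span B = UNIV) \<and>
     (\<forall>(U, \<phi>)\<in>A. chart U \<phi>) \<and>
     (\<Union>(U, \<phi>)\<in>A. U) = UNIV \<and>
     (\<forall>(U, \<phi>)\<in>A. \<forall>(V, \<psi>)\<in>A. smooth_on (\<phi> ` (U \<inter> V)) (\<psi> \<circ> inv_into U \<phi>))"

definition product_atlas :: "('m, 'e) atlas \<Rightarrow> ('n, 'f) atlas \<Rightarrow> ('m \<times> 'n, 'e \<times> 'f) atlas" where
  "product_atlas A B = {(U \<times> V, map_prod \<phi> \<psi>) |U \<phi> V \<psi>. (U, \<phi>) \<in> A \<and> (V, \<psi>) \<in> B}"

definition smooth_map ::
    "('m::topological_space, 'e::real_normed_vector) atlas \<Rightarrow>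
     ('n::topological_space, 'f::real_normed_vector) atlas \<Rightarrow> ('m \<Rightarrow> 'n) \<Rightarrow> bool" where
  "smooth_map A B F \<longleftrightarrow> continuous_on UNIV F \<and>
     (\<forall>(U, \<phi>)\<in>A. \<forall>(V, \<psi>)\<in>B. smooth_on (\<phi> ` (U \<inter> F -` V)) (\<psi> \<circ> F \<circ> inv_into U \<phi>))"

definition diffeomorphism :: "('m::topological_space, 'e::real_normed_vector) atlas \<Rightarrow> ('m \<Rightarrow> 'm) \<Rightarrow> bool" where
  "diffeomorphism A F \<longleftrightarrow> bij F \<and> smooth_map A A F \<and> smooth_map A A (inv F)"

definition smooth_fun_on :: "('m, 'e::real_normed_vector) atlas \<Rightarrow> 'm set \<Rightarrow> ('m \<Rightarrow> real) \<Rightarrow> bool" where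
  "smooth_fun_on A W f \<longleftrightarrow> (\<forall>(U, \<phi>)\<in>A. smooth_on (\<phi> ` (U \<inter> W)) (f \<circ> inv_into U \<phi>))"

definition smooth_near :: "('m::topological_space, 'e::real_normed_vector) atlas \<Rightarrow> 'm \<Rightarrow> ('m \<Rightarrow> real) \<Rightarrow> bool" where
  "smooth_near A p f \<longleftrightarrow> (\<exists>W. open W \<and> p \<in> W \<and> smooth_fun_on A W f)"


section \<open>Vector fields\<close>

text \<open>
  A tangent vector at \<open>p\<close> is a derivation at \<open>p\<close> of the algebra of functions that are defined and
  smooth on some neighbourhood of \<open>p\<close>.  Functions are total here, their values away from \<open>p\<close>
  being irrelevant; the derivation rules imply that \<open>v f\<close> depends only on the germ of \<open>f\<close> at \<open>p\<close>.
  The value 0 on functions that are not smooth near \<open>p\<close> is a normalisation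
  which makes equality of tangent vectors plain equality.
\<close>

definition tangent_space ::
    "('m::topological_space, 'e::real_normed_vector) atlas \<Rightarrow> 'm \<Rightarrow> (('m \<Rightarrow> real) \<Rightarrow> real) set" where
  "tangent_space A p = {v.
     (\<forall>f. \<not> smooth_near A p f \<longrightarrow> v f = 0) \<and>
     (\<forall>f g. smooth_near A p f \<and> smooth_near A p g \<longrightarrow>
        v (\<lambda>q. f q + g q) = v f + v g \<and>
        v (\<lambda>q. f q * g q) = f p * v g + g p * v f) \<and>
     (\<forall>c f. smooth_near A p f \<longrightarrow> v (\<lambda>q. c * f q) = c * v f)}"

type_synonym 'm vfield = "'m \<Rightarrow> ('m \<Rightarrow> real) \<Rightarrow> real"

definition vector_fields ::
    "('m::topological_space, 'e::real_normed_vector) atlas \<Rightarrow> 'm vfield set" where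
  "vector_fields A = {X. (\<forall>p. X p \<in> tangent_space A p) \<and>
     (\<forall>W f. open W \<and> smooth_fun_on A W f \<longrightarrow> smooth_fun_on A W (\<lambda>p. X p f))}"

definition vf_add :: "'m vfield \<Rightarrow> 'm vfield \<Rightarrow> 'm vfield" where
  "vf_add X Y = (\<lambda>p f. X p f + Y p f)"

definition vf_scale :: "('m \<Rightarrow> real) \<Rightarrow> 'm vfield \<Rightarrow> 'm vfield" where
  "vf_scale h X = (\<lambda>p f. h p * X p f)"

text \<open>The case distinction only enforces the normalisation of tangent vectors.\<close>

definition lie_bracket ::
    "('m::topological_space, 'e::real_normed_vector) atlas \<Rightarrow> 'm vfield \<Rightarrow> 'm vfield \<Rightarrow> 'm vfield" where
  "lie_bracket A X Y = (\<lambda>p f.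
     if smooth_near A p f then X p (\<lambda>q. Y q f) - Y p (\<lambda>q. X q f) else 0)"

text \<open>
  Push-forward along a diffeomorphism \<open>F\<close>: at \<open>q = F p\<close> its value is \<open>d F\<^sub>p (X p)\<close>, where
  \<open>(d F\<^sub>p v) f = v (f \<circ> F)\<close>.
\<close>

definition pushforward :: "('m \<Rightarrow> 'm) \<Rightarrow> 'm vfield \<Rightarrow> 'm vfield" where
  "pushforward F X = (\<lambda>q f. X (inv F q) (f \<circ> F))"


section \<open>Linear connections\<close>

text \<open>
  A connection is an operator \<open>D X Y = \<nabla>\<^sub>X Y\<close> on vector fields; its values on other arguments are
  unconstrained.  Homogeneity over the reals in the second argument is the
  Leibniz rule for constant \<open>h\<close>.
\<close>

definition linear_connection ::
    "('m::topological_space, 'e::real_normed_vector) atlas \<Rightarrow>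
     ('m vfield \<Rightarrow> 'm vfield \<Rightarrow> 'm vfield) \<Rightarrow> bool" where
  "linear_connection A D \<longleftrightarrow>
     (\<forall>X\<in>vector_fields A. \<forall>Y\<in>vector_fields A. D X Y \<in> vector_fields A) \<and>
     (\<forall>X\<in>vector_fields A. \<forall>X'\<in>vector_fields A. \<forall>Y\<in>vector_fields A.
        D (vf_add X X') Y = vf_add (D X Y) (D X' Y)) \<and>
     (\<forall>h. \<forall>X\<in>vector_fields A. \<forall>Y\<in>vector_fields A. smooth_fun_on A UNIV h \<longrightarrow>
        D (vf_scale h X) Y = vf_scale h (D X Y)) \<and>
     (\<forall>X\<in>vector_fields A. \<forall>Y\<in>vector_fields A. \<forall>Y'\<in>vector_fields A.
        D X (vf_add Y Y') = vf_add (D X Y) (D X Y')) \<and>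
     (\<forall>h. \<forall>X\<in>vector_fields A. \<forall>Y\<in>vector_fields A. smooth_fun_on A UNIV h \<longrightarrow>
        D X (vf_scale h Y) = vf_add (vf_scale (\<lambda>p. X p h) Y) (vf_scale h (D X Y)))"

definition torsion ::
    "('m::topological_space, 'e::real_normed_vector) atlas \<Rightarrow>
     ('m vfield \<Rightarrow> 'm vfield \<Rightarrow> 'm vfield) \<Rightarrow> 'm vfield \<Rightarrow> 'm vfield \<Rightarrow> 'm vfield" where
  "torsion A D X Y = (\<lambda>p f. D X Y p f - D Y X p f - lie_bracket A X Y p f)"

definition symmetric_connection ::
    "('m::topological_space, 'e::real_normed_vector) atlas \<Rightarrow>
     ('m vfield \<Rightarrow> 'm vfield \<Rightarrow> 'm vfield) \<Rightarrow> bool" where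
  "symmetric_connection A D \<longleftrightarrow>
     (\<forall>X\<in>vector_fields A. \<forall>Y\<in>vector_fields A. torsion A D X Y = (\<lambda>p f. 0))"

definition affine_transformation ::
    "('m::topological_space, 'e::real_normed_vector) atlas \<Rightarrow>
     ('m vfield \<Rightarrow> 'm vfield \<Rightarrow> 'm vfield) \<Rightarrow> ('m \<Rightarrow> 'm) \<Rightarrow> bool" where
  "affine_transformation A D F \<longleftrightarrow> diffeomorphism A F \<and>
     (\<forall>X\<in>vector_fields A. \<forall>Y\<in>vector_fields A.
        pushforward F (D X Y) = D (pushforward F X) (pushforward F Y))"


section \<open>Lie groups\<close>

text \<open>
  Here \<open>group\<close> is the locale of \<open>HOL.Groups\<close>, for a group whose carrier is the whole type.
\<close>

definition lie_group ::
    "('g::{t2_space,second_countable_topology}, 'e::{real_inner,banach}) atlas \<Rightarrow>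
     ('g \<Rightarrow> 'g \<Rightarrow> 'g) \<Rightarrow> 'g \<Rightarrow> ('g \<Rightarrow> 'g) \<Rightarrow> bool" where
  "lie_group A mul e i \<longleftrightarrow> smooth_manifold A \<and> group mul e i \<and>
     smooth_map (product_atlas A A) A (\<lambda>(g, h). mul g h) \<and> smooth_map A A i"

definition left_invariant_vf ::
    "('g::topological_space, 'e::real_normed_vector) atlas \<Rightarrow> ('g \<Rightarrow> 'g \<Rightarrow> 'g) \<Rightarrow> 'g vfield set" where
  "left_invariant_vf A mul =
     {X \<in> vector_fields A. \<forall>g. pushforward (\<lambda>h. mul g h) X = X}"

definition right_invariant_vf ::
    "('g::topological_space, 'e::real_normed_vector) atlas \<Rightarrow> ('g \<Rightarrow> 'g \<Rightarrow> 'g) \<Rightarrow> 'g vfield set" where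
  "right_invariant_vf A mul =
     {X \<in> vector_fields A. \<forall>g. pushforward (\<lambda>h. mul h g) X = X}"

definition left_invariant_connection ::
    "('g::topological_space, 'e::real_normed_vector) atlas \<Rightarrow> ('g \<Rightarrow> 'g \<Rightarrow> 'g) \<Rightarrow>
     ('g vfield \<Rightarrow> 'g vfield \<Rightarrow> 'g vfield) \<Rightarrow> bool" where
  "left_invariant_connection A mul D \<longleftrightarrow> (\<forall>g. affine_transformation A D (\<lambda>h. mul g h))"

definition right_invariant_connection ::
    "('g::topological_space, 'e::real_normed_vector) atlas \<Rightarrow> ('g \<Rightarrow> 'g \<Rightarrow> 'g) \<Rightarrow>
     ('g vfield \<Rightarrow> 'g vfield \<Rightarrow> 'g vfield) \<Rightarrow> bool" where
  "right_invariant_connection A mul D \<longleftrightarrow> (\<forall>g. affine_transformation A D (\<lambda>h. mul h g))"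

definition bi_invariant_connection ::
    "('g::topological_space, 'e::real_normed_vector) atlas \<Rightarrow> ('g \<Rightarrow> 'g \<Rightarrow> 'g) \<Rightarrow>
     ('g vfield \<Rightarrow> 'g vfield \<Rightarrow> 'g vfield) \<Rightarrow> bool" where
  "bi_invariant_connection A mul D \<longleftrightarrow>
     left_invariant_connection A mul D \<and> right_invariant_connection A mul D"

end

theory Submission
  imports Defs
begin

text \<open>
  Let \<open>E\<^sub>b\<close> be a frame of left-invariant vector fields.  Every vector field is a combination of the
  \<open>E\<^sub>b\<close> with smooth coefficients (\<open>left_invariant_frame\<close>), so two connections that agree on
  the pairs \<open>(E\<^sub>b, E\<^sub>c)\<close> are equal, and a torsion tensor that vanishes on these pairs is zero.  The
  latter applies to \<open>\<nabla>\<close> because \<open>1/2 [X, Y] - 1/2 [Y, X] = [X, Y]\<close>.  The former gives left-invariance: the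
  transport of \<open>\<nabla>\<close> along a left translation agrees with \<open>\<nabla>\<close> on left-invariant fields, since
  these are fixed by the translation and so are their brackets.

  The link between left and right is that a left-invariant field \<open>X\<close> and a right-invariant field
  \<open>R\<close> commute (\<open>lie_bracket_left_right_invariant\<close>).  Write \<open>R = \<Sum>\<^sub>b a\<^sub>b E\<^sub>b\<close> and \<open>M(Y) = \<Sum>\<^sub>b Y(a\<^sub>b) E\<^sub>b\<close>.
  From \<open>[E\<^sub>c, R] = 0\<close> one reads off \<open>\<Sum>\<^sub>b a\<^sub>b [E\<^sub>b, E\<^sub>c] = M(E\<^sub>c)\<close>, hence \<open>\<nabla>\<^sub>R E\<^sub>c = 1/2 M(E\<^sub>c)\<close>.  As both
  \<open>\<nabla>\<^sub>R Y - [R, Y]\<close> and \<open>M(Y)\<close> are linear over the smooth functions in \<open>Y\<close>, it follows that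
  \<open>\<nabla>\<^sub>R Y = [R, Y] + 1/2 M(Y)\<close> for all \<open>Y\<close>.  If \<open>S\<close> is right-invariant too, then \<open>[S, E\<^sub>b] = 0\<close> gives
  \<open>[S, R] = M(S)\<close>, and so \<open>\<nabla>\<^sub>R S = [R, S] + 1/2 [S, R] = 1/2 [R, S]\<close>.  Thus \<open>\<nabla>\<close> satisfies the hypothesis for
  the opposite group, where left and right are exchanged, and right-invariance and the
  uniqueness of \<open>\<nabla>\<close> follow from what was proved for left translations and left-invariant frames.

  The analysis behind this consists of three facts.  By Hadamard's lemma a derivation at a point
  is a directional derivative in a chart (\<open>tangent_eq_directional_derivative\<close>), so that tangent
  vectors at \<open>e\<close> extend to smooth invariant fields and the coefficients with respect to the frame
  are smooth (both by \<open>smooth_near_vector_field_along\<close>).  Second derivatives are symmetric, so that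
  tangent vectors acting on different variables commute (\<open>tangent_vectors_commute\<close>).  Smoothness
  is preserved by composition, which is the chain rule in finite dimension (\<open>Ck_on_comp\<close>).
\<close>


section \<open>Smooth functions of several variables\<close>

lemma Ck_on_Suc_has_derivative:
  "Ck_on (Suc k) S f \<Longrightarrow> x \<in> S \<Longrightarrow> (f has_derivative frechet_derivative f (at x)) (at x)"
  by (auto simp: frechet_derivative_works)

lemma Ck_on_Suc_derivative: "Ck_on (Suc k) S f \<Longrightarrow> Ck_on k S (\<lambda>x. frechet_derivative f (at x) v)"
  by simp

lemma Ck_on_subset: "Ck_on k S f \<Longrightarrow> T \<subseteq> S \<Longrightarrow> Ck_on k T f"
  by (induction k arbitrary: f) (auto intro: continuous_on_subset)

lemma Ck_on_Suc_imp: "Ck_on (Suc k) S f \<Longrightarrow> Ck_on k S f"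
proof (induction k arbitrary: f)
  case 0
  then show ?case
    by (auto intro!: continuous_at_imp_continuous_on differentiable_imp_continuous_within)
next
  case (Suc k)
  then show ?case by simp
qed

lemma Ck_on_imp_continuous_on: "Ck_on k S f \<Longrightarrow> continuous_on S f"
proof (induction k)
  case (Suc k)
  then show ?case using Ck_on_Suc_imp by blast
qed simp

lemma Ck_on_cong:
  assumes "open S" "\<And>x. x \<in> S \<Longrightarrow> f x = g x" "Ck_on k S f"
  shows "Ck_on k S g"
  using assms(2,3)
proof (induction k arbitrary: f g)
  case 0
  then show ?case by (metis Ck_on.simps(1) continuous_on_cong)
next
  case (Suc k)
  have "(g has_derivative frechet_derivative f (at x)) (at x)" if "x \<in> S" for x
    using has_derivative_transform_within_open[OF Ck_on_Suc_has_derivative assms(1) that]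
      Suc.prems that by blast
  then have *: "g differentiable at x" "frechet_derivative f (at x) = frechet_derivative g (at x)"
    if "x \<in> S" for x
    using that by (auto simp: differentiable_def dest: frechet_derivative_at)
  have "Ck_on k S (\<lambda>x. frechet_derivative g (at x) v)" for v
    by (rule Suc.IH[of "\<lambda>x. frechet_derivative f (at x) v"]) (use * Suc.prems(2) in auto)
  then show ?case using * by simp
qed

lemma Ck_on_SucI:
  assumes "open S" "\<And>x. x \<in> S \<Longrightarrow> (f has_derivative f' x) (at x)"
    and "\<And>v. Ck_on k S (\<lambda>x. f' x v)"
  shows "Ck_on (Suc k) S f"
proof -
  have *: "f differentiable at x" "f' x = frechet_derivative f (at x)" if "x \<in> S" for x
    using assms(2)[OF that] by (auto simp: differentiable_def dest: frechet_derivative_at)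
  have "Ck_on k S (\<lambda>x. frechet_derivative f (at x) v)" for v
    by (rule Ck_on_cong[OF assms(1) _ assms(3)[of v]]) (simp add: *)
  with * show ?thesis by simp
qed

text \<open>
  Smoothness is a condition on derivatives at single points, and these depend only on a
  neighbourhood.
\<close>

lemma Ck_on_local:
  assumes "\<And>x. x \<in> S \<Longrightarrow> \<exists>T. open T \<and> x \<in> T \<and> Ck_on k T f"
  shows "Ck_on k S f"
  using assms
proof (induction k arbitrary: f)
  case 0
  have "continuous (at x) f" if "x \<in> S" for x
    using 0[OF that] by (auto simp: continuous_on_eq_continuous_at)
  then show ?case by (simp add: continuous_at_imp_continuous_on)
next
  case (Suc k)
  have "Ck_on k S (\<lambda>x. frechet_derivative f (at x) v)" for v
  proof (rule Suc.IH)
    fix x assume "x \<in> S"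
    then obtain T where "open T" "x \<in> T" "Ck_on (Suc k) T f" using Suc.prems by blast
    then show "\<exists>T. open T \<and> x \<in> T \<and> Ck_on k T (\<lambda>x. frechet_derivative f (at x) v)"
      by (intro exI[of _ T]) simp
  qed
  moreover have "f differentiable at x" if "x \<in> S" for x
    using Suc.prems[OF that] by auto
  ultimately show ?case by simp
qed

lemma Ck_on_const: "Ck_on k S (\<lambda>x. c)"
  by (induction k arbitrary: c) auto

lemma Ck_on_bounded_linear_comp:
  assumes "bounded_linear L" "open S" "Ck_on k S f"
  shows "Ck_on k S (\<lambda>x. L (f x))"
  using assms(3)
proof (induction k arbitrary: f)
  case 0
  then show ?case
    using bounded_linear.continuous_on[OF assms(1)] by simp
next
  case (Suc k)
  show ?case
    by (rule Ck_on_SucI[OF assms(2) bounded_linear.has_derivative[OF assms(1)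
          Ck_on_Suc_has_derivative[OF Suc.prems]]])
      (use Suc in auto)
qed

lemma Ck_on_ident: "open S \<Longrightarrow> Ck_on k S (\<lambda>x. x)"
  by (induction k) (auto intro: Ck_on_const simp: continuous_on_id)

lemma Ck_on_bounded_linear: "bounded_linear L \<Longrightarrow> open S \<Longrightarrow> Ck_on k S L"
  using Ck_on_bounded_linear_comp[OF _ _ Ck_on_ident] .

lemma Ck_on_add:
  assumes "open S" "Ck_on k S f" "Ck_on k S g"
  shows "Ck_on k S (\<lambda>x. f x + g x)"
  using assms(2,3)
proof (induction k arbitrary: f g)
  case (Suc k)
  show ?case
    by (rule Ck_on_SucI[OF assms(1), where f' = "\<lambda>x v. frechet_derivative f (at x) v +
          frechet_derivative g (at x) v"])
       (use Suc in \<open>auto intro!: has_derivative_add Ck_on_Suc_has_derivative[where k=k]\<close>)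
qed (auto intro: continuous_intros)

lemma Ck_on_sum:
  assumes "open S" "\<And>i. i \<in> I \<Longrightarrow> Ck_on k S (f i)"
  shows "Ck_on k S (\<lambda>x. \<Sum>i\<in>I. f i x)"
  using assms(2)
  by (induction I rule: infinite_finite_induct) (auto intro: Ck_on_const Ck_on_add[OF assms(1)])

lemma Ck_on_bilinear:
  assumes "bounded_bilinear m" "open S" "Ck_on k S f" "Ck_on k S g"
  shows "Ck_on k S (\<lambda>x. m (f x) (g x))"
  using assms(3,4)
proof (induction k arbitrary: f g)
  case 0
  then show ?case
    using bounded_bilinear.continuous_on[OF assms(1)] by simp
next
  case (Suc k)
  show ?case
  proof (rule Ck_on_SucI[OF assms(2)])
    show "((\<lambda>x. m (f x) (g x)) has_derivative (\<lambda>v. m (f x) (frechet_derivative g (at x) v) +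
        m (frechet_derivative f (at x) v) (g x))) (at x)" if "x \<in> S" for x
      using Suc.prems that
      by (intro bounded_bilinear.FDERIV[OF assms(1)] Ck_on_Suc_has_derivative)
    show "Ck_on k S (\<lambda>x. m (f x) (frechet_derivative g (at x) v) +
        m (frechet_derivative f (at x) v) (g x))" for v
      by (rule Ck_on_add[OF assms(2) Suc.IH[OF Ck_on_Suc_imp[OF Suc.prems(1)]
              Ck_on_Suc_derivative[OF Suc.prems(2)]]
            Suc.IH[OF Ck_on_Suc_derivative[OF Suc.prems(1)] Ck_on_Suc_imp[OF Suc.prems(2)]]])
  qed
qed

text \<open>
  The expansion property of an orthonormal basis, in a form that includes the spaces of
  dimension 0, where the empty set has it.
\<close>

definition resolves_identity :: "'a::real_inner set \<Rightarrow> bool" where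
  "resolves_identity B \<longleftrightarrow> finite B \<and> (\<forall>x. (\<Sum>b\<in>B. (x \<bullet> b) *\<^sub>R b) = x)"

lemma resolves_identity_exists:
  fixes C :: "'a::real_inner set"
  assumes "finite C" "span C = UNIV"
  obtains B :: "'a set" where "resolves_identity B"
proof -
  obtain D :: "'a set" where D: "finite D" "span D = UNIV" "pairwise orthogonal D"
    using basis_orthogonal[OF assms(1)] assms(2) by auto
  \<comment> \<open>An orthogonal spanning set may contain 0; its other members are normalised.\<close>
  define B where "B = (\<lambda>d. d /\<^sub>R norm d) ` (D - {0})"
  have inj: "inj_on (\<lambda>d. d /\<^sub>R norm d) (D - {0})"
  proof (rule inj_onI, rule ccontr)
    fix x y assume *: "x \<in> D - {0}" "y \<in> D - {0}" "x /\<^sub>R norm x = y /\<^sub>R norm y" "x \<noteq> y"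
    then have "x \<bullet> y = 0" using D(3) by (auto simp: pairwise_def orthogonal_def)
    then have "(x /\<^sub>R norm x) \<bullet> (y /\<^sub>R norm y) = 0" by simp
    with * have "(x /\<^sub>R norm x) \<bullet> (x /\<^sub>R norm x) = 0" by simp
    with * show False by simp
  qed
  have B: "(\<Sum>b\<in>B. (x \<bullet> b) *\<^sub>R b) = (\<Sum>d\<in>D - {0}. ((x \<bullet> d) / (d \<bullet> d)) *\<^sub>R d)" for x
    unfolding B_def sum.reindex[OF inj]
    by (simp add: o_def divide_inverse power2_norm_eq_inner[symmetric] power2_eq_square mult_ac)
  have lin: "linear (\<lambda>x. \<Sum>b\<in>B. (x \<bullet> b) *\<^sub>R b)"
    by (intro linearI)
       (simp_all add: inner_add_left scaleR_add_left sum.distrib scaleR_sum_right)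
  have "(\<Sum>b\<in>B. (x \<bullet> b) *\<^sub>R b) = id x" if "x \<in> D" for x
  proof (cases "x = 0")
    case False
    have "(\<Sum>d\<in>D - {0}. ((x \<bullet> d) / (d \<bullet> d)) *\<^sub>R d) = (\<Sum>d\<in>D - {0}. if d = x then x else 0)"
      using D(3) that by (intro sum.cong) (auto simp: pairwise_def orthogonal_def)
    then show ?thesis using that False D(1) by (simp add: B)
  qed simp
  then have "(\<Sum>b\<in>B. (x \<bullet> b) *\<^sub>R b) = id x" for x
    using linear_eq_on_span[OF lin linear_id, of D x] D(2) by auto
  then have "resolves_identity B"
    using D(1) by (simp add: resolves_identity_def B_def)
  then show thesis ..
qed

lemma resolves_identity_linear:
  assumes "resolves_identity B" "linear L"
  shows "L x = (\<Sum>b\<in>B. (x \<bullet> b) *\<^sub>R L b)"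
proof -
  have "L x = L (\<Sum>b\<in>B. (x \<bullet> b) *\<^sub>R b)"
    using assms(1) by (simp add: resolves_identity_def)
  then show ?thesis
    by (simp add: linear_sum[OF assms(2)] linear_cmul[OF assms(2)])
qed

text \<open>
  Without 0 in the second factor the two images are disjoint; 0 contributes nothing to an
  expansion.
\<close>

lemma resolves_identity_Times:
  assumes "resolves_identity B" "resolves_identity C"
  shows "resolves_identity ((\<lambda>b. (b, 0)) ` B \<union> (\<lambda>c. (0, c)) ` (C - {0}))"
proof -
  have inj: "inj_on (\<lambda>b. (b, 0)) B" "inj_on (\<lambda>c. (0, c)) (C - {0})" by (auto simp: inj_on_def)
  have disj: "(\<lambda>b. (b, 0)) ` B \<inter> (\<lambda>c. (0, c)) ` (C - {0}) = {}" by auto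
  have f: "finite B" "finite C" using assms by (auto simp: resolves_identity_def)
  have "(\<Sum>c\<in>C - {0}. (y \<bullet> c) *\<^sub>R c) = (\<Sum>c\<in>C. (y \<bullet> c) *\<^sub>R c)" for y
    using f by (intro sum.mono_neutral_left) auto
  then show ?thesis
    using assms f by (auto simp: resolves_identity_def sum.union_disjoint[OF _ _ disj]
        sum.reindex[OF inj(1)] sum.reindex[OF inj(2)] sum_prod)
qed

text \<open>
  The chain rule differentiates \<open>g\<close> in a direction \<open>Df(x) v\<close> that moves with \<open>x\<close>.  Expanding this
  direction along \<open>B\<close> leaves derivatives of \<open>g\<close> in fixed directions, which are again
  compositions of the form in question, with smooth coefficients.
\<close>

lemma Ck_on_comp:
  fixes f :: "'a::real_normed_vector \<Rightarrow> 'b::real_inner" and g :: "'b \<Rightarrow> 'c::real_normed_vector"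
  assumes B: "resolves_identity (B :: 'b set)"
    and "open S" "open T" "f ` S \<subseteq> T" "Ck_on k S f" "Ck_on k T g"
  shows "Ck_on k S (\<lambda>x. g (f x))"
  using assms(5,6)
proof (induction k arbitrary: g)
  case 0
  then show ?case using assms(4) by (auto intro: continuous_on_compose2)
next
  case (Suc k)
  have fT: "f x \<in> T" if "x \<in> S" for x using assms(4) that by auto
  let ?g' = "\<lambda>x v. \<Sum>b\<in>B. (frechet_derivative f (at x) v \<bullet> b) *\<^sub>R frechet_derivative g (at (f x)) b"
  have "((\<lambda>x. g (f x)) has_derivative ?g' x) (at x)" if x: "x \<in> S" for x
  proof -
    have *: "(g has_derivative frechet_derivative g (at (f x))) (at (f x))"
      using Suc.prems(2) fT[OF x] by (rule Ck_on_Suc_has_derivative)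
    then have "linear (frechet_derivative g (at (f x)))"
      by (rule has_derivative_linear)
    then have "?g' x = (\<lambda>v. frechet_derivative g (at (f x)) (frechet_derivative f (at x) v))"
      by (intro ext) (rule resolves_identity_linear[OF B, symmetric])
    with has_derivative_compose[OF Ck_on_Suc_has_derivative[OF Suc.prems(1) x] *]
    show ?thesis by simp
  qed
  moreover have "Ck_on k S (\<lambda>x. ?g' x v)" for v
  proof (intro Ck_on_sum assms(2) Ck_on_bilinear[OF bounded_bilinear_scaleR]
      Ck_on_bounded_linear_comp[OF bounded_linear_inner_left] Suc.IH)
    show "Ck_on k S f" using Suc.prems(1) by (rule Ck_on_Suc_imp)
  qed (use Suc.prems in auto)
  ultimately show ?case by (intro Ck_on_SucI[OF assms(2)])
qed

lemma Ck_on_Pair: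
  assumes "open S" "Ck_on k S f" "Ck_on k S g"
  shows "Ck_on k S (\<lambda>x. (f x, g x))"
proof -
  have "bounded_linear (\<lambda>x. (x, 0))" "bounded_linear (\<lambda>x. (0, x))"
    by (intro bounded_linear_Pair bounded_linear_ident bounded_linear_zero)+
  from Ck_on_bounded_linear_comp[OF this(1) assms(1,2)]
       Ck_on_bounded_linear_comp[OF this(2) assms(1,3)]
  show ?thesis using Ck_on_add[OF assms(1)] by fastforce
qed

text \<open>
  The mean value theorem is applied in direction \<open>a\<close> to the increment of \<open>f\<close> along \<open>h b\<close>, and
  then in direction \<open>b\<close> to the derivative of \<open>f\<close> along \<open>a\<close>.
\<close>

lemma second_difference_eq:
  fixes f :: "'a::real_normed_vector \<Rightarrow> real"
  assumes "Ck_on 2 (ball z r) f" "0 < h" "h * (norm a + norm b) < r"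
  shows "\<exists>\<xi>\<in>{0..h}. \<exists>\<eta>\<in>{0..h}.
    f (z + h *\<^sub>R a + h *\<^sub>R b) - f (z + h *\<^sub>R a) - f (z + h *\<^sub>R b) + f z =
    h * h * frechet_derivative (\<lambda>x. frechet_derivative f (at x) a) (at (z + \<xi> *\<^sub>R a + \<eta> *\<^sub>R b)) b"
proof -
  let ?f' = "\<lambda>x. frechet_derivative f (at x) a"
  have C: "Ck_on (Suc 1) (ball z r) f" "Ck_on (Suc 0) (ball z r) ?f'"
    using assms(1) by (simp_all add: numeral_2_eq_2)
  have near: "z + s *\<^sub>R a + t *\<^sub>R b \<in> ball z r" if "s \<in> {0..h}" "t \<in> {0..h}" for s t
  proof -
    have "norm (s *\<^sub>R a + t *\<^sub>R b) \<le> s * norm a + t * norm b"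
      using that norm_triangle_ineq[of "s *\<^sub>R a" "t *\<^sub>R b"] by simp
    also have "\<dots> \<le> h * norm a + h * norm b"
      using that by (intro add_mono mult_right_mono) auto
    finally have "dist (z + (s *\<^sub>R a + t *\<^sub>R b)) z < r"
      using assms(3) by (simp add: dist_norm distrib_left)
    then show ?thesis by (simp add: add.assoc dist_commute)
  qed
  have line: "((\<lambda>s. g (y + s *\<^sub>R c)) has_derivative
      (\<lambda>k. k * frechet_derivative g (at (y + s *\<^sub>R c)) c)) (at s)"
    if "Ck_on (Suc k) (ball z r) g" "y + s *\<^sub>R c \<in> ball z r" for g :: "'a \<Rightarrow> real" and y c s k
  proof -
    have g: "(g has_derivative frechet_derivative g (at (y + s *\<^sub>R c))) (at (y + s *\<^sub>R c))"
      by (rule Ck_on_Suc_has_derivative[OF that])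
    have "((\<lambda>s. y + s *\<^sub>R c) has_derivative (\<lambda>k. k *\<^sub>R c)) (at s)"
      by (auto intro!: derivative_eq_intros)
    from has_derivative_compose[OF this g] show ?thesis
      using linear_cmul[OF has_derivative_linear[OF g]] by simp
  qed
  let ?\<phi> = "\<lambda>s. f (z + h *\<^sub>R b + s *\<^sub>R a) - f (z + s *\<^sub>R a)"
  have "\<exists>\<xi>\<in>{0..h}. ?\<phi> h - ?\<phi> 0 = (\<lambda>k. k * ?f' (z + h *\<^sub>R b + \<xi> *\<^sub>R a) - k * ?f' (z + \<xi> *\<^sub>R a)) (h - 0)"
  proof (rule mvt_very_simple)
    fix s assume s: "0 \<le> s" "s \<le> h"
    show "(?\<phi> has_derivative (\<lambda>k. k * ?f' (z + h *\<^sub>R b + s *\<^sub>R a) - k * ?f' (z + s *\<^sub>R a))) (at s within {0..h})"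
      using near[of s h] near[of s 0] s assms(2)
      by (intro has_derivative_diff has_derivative_at_withinI[OF line[OF C(1)]]) (auto simp: algebra_simps)
  qed (use assms in auto)
  then obtain \<xi> where \<xi>: "\<xi> \<in> {0..h}"
    "?\<phi> h - ?\<phi> 0 = h * (?f' (z + h *\<^sub>R b + \<xi> *\<^sub>R a) - ?f' (z + \<xi> *\<^sub>R a))"
    by (auto simp: algebra_simps)
  let ?\<psi> = "\<lambda>t. ?f' (z + \<xi> *\<^sub>R a + t *\<^sub>R b)"
  have "\<exists>\<eta>\<in>{0..h}. ?\<psi> h - ?\<psi> 0 = (\<lambda>k. k * frechet_derivative ?f' (at (z + \<xi> *\<^sub>R a + \<eta> *\<^sub>R b)) b) (h - 0)"
  proof (rule mvt_very_simple)
    fix t assume "0 \<le> t" "t \<le> h"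
    then show "(?\<psi> has_derivative (\<lambda>k. k * frechet_derivative ?f' (at (z + \<xi> *\<^sub>R a + t *\<^sub>R b)) b)) (at t within {0..h})"
      using near[OF \<xi>(1), of t] by (intro has_derivative_at_withinI[OF line[OF C(2)]]) auto
  qed (use assms in auto)
  then obtain \<eta> where "\<eta> \<in> {0..h}"
    "?\<psi> h - ?\<psi> 0 = h * frechet_derivative ?f' (at (z + \<xi> *\<^sub>R a + \<eta> *\<^sub>R b)) b"
    by auto
  with \<xi> show ?thesis
    by (intro bexI[of _ \<xi>] bexI[of _ \<eta>]) (auto simp: add.assoc add.commute add.left_commute)
qed

text \<open>
  The second difference is symmetric in \<open>a\<close> and \<open>b\<close>.  Divided by \<open>h\<^sup>2\<close>, it is a value of either
  iterated derivative at points that tend to \<open>z\<close> with \<open>h\<close>.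
\<close>

lemma second_derivative_symmetric:
  fixes f :: "'a::real_normed_vector \<Rightarrow> real"
  assumes "open S" "z \<in> S" "Ck_on 2 S f"
  shows "frechet_derivative (\<lambda>x. frechet_derivative f (at x) a) (at z) b =
    frechet_derivative (\<lambda>x. frechet_derivative f (at x) b) (at z) a"
proof -
  define F where "F a b x = frechet_derivative (\<lambda>x. frechet_derivative f (at x) a) (at x) b" for a b x
  have cont: "continuous_on S (F a b)" for a b
    using assms(3) by (simp add: numeral_2_eq_2 F_def)
  obtain r where r: "0 < r" "ball z r \<subseteq> S"
    using assms(1,2) by (meson open_contains_ball)
  have "\<bar>F a b z - F b a z\<bar> \<le> 2 * \<epsilon>" if "\<epsilon> > 0" for \<epsilon>
  proof -
    have "\<forall>\<^sub>F x in at z. dist (F a b x) (F a b z) < \<epsilon> \<and> dist (F b a x) (F b a z) < \<epsilon>" for a b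
      using cont[of a b] cont[of b a] assms(1,2) that
      by (auto simp: continuous_on_eq_continuous_at continuous_at intro!: eventually_conj tendstoD)
    then have "\<forall>\<^sub>F x in nhds z. dist (F a b x) (F a b z) < \<epsilon> \<and> dist (F b a x) (F b a z) < \<epsilon>"
      using that by (auto simp: eventually_nhds_conv_at)
    then obtain d where d: "d > 0" "\<And>x. dist x z < d \<Longrightarrow>
        dist (F a b x) (F a b z) < \<epsilon> \<and> dist (F b a x) (F b a z) < \<epsilon>"
      by (auto simp: eventually_nhds_metric)
    \<comment> \<open>For this step size all points that occur stay in the ball and within distance d of z.\<close>
    define h where "h = min r d / (2 * (norm a + norm b + 1))"
    have n: "0 < norm a + norm b + 1" by (simp add: add_nonneg_pos)
    have h: "0 < h" using r d n by (simp add: h_def)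
    have "h * (norm a + norm b + 1) = min r d / 2"
      using n by (simp add: h_def field_simps)
    then have "h * (norm a + norm b) < min r d"
      using h r d by (simp add: algebra_simps) linarith
    then have hr: "h * (norm a + norm b) < r" and hd: "h * (norm a + norm b) < d" by auto
    have near: "dist (z + s *\<^sub>R a + t *\<^sub>R b) z < d" if "s \<in> {0..h}" "t \<in> {0..h}" for s t
    proof -
      have "norm (s *\<^sub>R a + t *\<^sub>R b) \<le> s * norm a + t * norm b"
        using that norm_triangle_ineq[of "s *\<^sub>R a" "t *\<^sub>R b"] by simp
      also have "\<dots> \<le> h * norm a + h * norm b"
        using that by (intro add_mono mult_right_mono) auto
      also have "\<dots> < d" using hd by (simp add: distrib_left)
      finally show ?thesis by (simp add: dist_norm add.assoc)
    qed
    have C: "Ck_on 2 (ball z r) f" using Ck_on_subset[OF assms(3) r(2)] .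
    obtain s t where st: "s \<in> {0..h}" "t \<in> {0..h}"
      "f (z + h *\<^sub>R a + h *\<^sub>R b) - f (z + h *\<^sub>R a) - f (z + h *\<^sub>R b) + f z =
        h * h * F a b (z + s *\<^sub>R a + t *\<^sub>R b)"
      using second_difference_eq[OF C h hr] unfolding F_def by blast
    have hr': "h * (norm b + norm a) < r" using hr by (simp add: add.commute)
    obtain s' t' where st': "s' \<in> {0..h}" "t' \<in> {0..h}"
      "f (z + h *\<^sub>R b + h *\<^sub>R a) - f (z + h *\<^sub>R b) - f (z + h *\<^sub>R a) + f z =
        h * h * F b a (z + s' *\<^sub>R b + t' *\<^sub>R a)"
      using second_difference_eq[OF C h hr'] unfolding F_def by blast
    have "h * h * F a b (z + s *\<^sub>R a + t *\<^sub>R b) = h * h * F b a (z + s' *\<^sub>R b + t' *\<^sub>R a)"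
      unfolding st(3)[symmetric] st'(3)[symmetric] by (simp add: algebra_simps)
    then have "F a b (z + s *\<^sub>R a + t *\<^sub>R b) = F b a (z + t' *\<^sub>R a + s' *\<^sub>R b)"
      using h by (simp add: algebra_simps)
    then show ?thesis
      using d(2)[OF near[OF st(1,2)]] d(2)[OF near[OF st'(2,1)]]
      unfolding dist_real_def by linarith
  qed
  from this[of "\<bar>F a b z - F b a z\<bar> / 4"] have "F a b z = F b a z"
    by (cases "0 < \<bar>F a b z - F b a z\<bar> / 4") auto
  then show ?thesis by (simp add: F_def)
qed


lemma radial_in_ball:
  fixes z :: "'a::real_normed_vector"
  assumes "x \<in> ball z r" "t \<in> {0..1}"
  shows "z + t *\<^sub>R (x - z) \<in> ball z r"
proof -
  have "dist z (z + t *\<^sub>R (x - z)) = t * dist z x"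
    using assms(2) by (simp add: dist_norm norm_minus_commute)
  also have "\<dots> \<le> dist z x" using assms(2) by (simp add: mult_left_le_one_le)
  finally show ?thesis using assms(1) by simp
qed

text \<open>
  Differentiation under the integral sign produces a factor \<open>t\<close>; the power of \<open>t\<close> makes the
  statement stable under it.
\<close>

lemma Ck_on_radial_integral:
  fixes f :: "'a::{real_inner,banach} \<Rightarrow> real"
  assumes B: "resolves_identity (B :: 'a set)" and "Ck_on k (ball z r) f"
  shows "Ck_on k (ball z r) (\<lambda>x. integral (cbox 0 1) (\<lambda>t. t ^ m * f (z + t *\<^sub>R (x - z))))"
  using assms(2)
proof (induction k arbitrary: f m)
  case 0
  have "continuous_on (ball z r) f" using 0 by simp
  moreover have "(\<lambda>p. z + snd p *\<^sub>R (fst p - z)) ` (ball z r \<times> cbox 0 1) \<subseteq> ball z r"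
    using radial_in_ball[where z=z and r=r] by (auto simp del: mem_ball)
  ultimately have "continuous_on (ball z r \<times> cbox 0 1) (\<lambda>p. f (z + snd p *\<^sub>R (fst p - z)))"
    by (intro continuous_on_compose2[of "ball z r" f _ "\<lambda>p. z + snd p *\<^sub>R (fst p - z)"])
      (simp_all add: continuous_intros)
  then have "continuous_on (ball z r \<times> cbox 0 1) (\<lambda>(x, t). t ^ m * f (z + t *\<^sub>R (x - z)))"
    unfolding case_prod_beta by (intro continuous_on_mult) (auto intro!: continuous_intros)
  from integral_continuous_on_param[OF this] show ?case by simp
next
  case (Suc k)
  define F where "F x v = frechet_derivative f (at x) v" for x v
  have contF: "continuous_on (ball z r) (\<lambda>x. F x v)" for v
    using Suc.prems by (auto simp: F_def intro!: Ck_on_imp_continuous_on)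
  have df: "(f has_derivative F y) (at y)" if "y \<in> ball z r" for y
    unfolding F_def using Suc.prems that by (rule Ck_on_Suc_has_derivative)
  \<comment> \<open>The derivative of the integrand as a bounded operator; its expansion shows that it is continuous in (x, t).\<close>
  define G where "G x t = (\<Sum>b\<in>B. (t ^ Suc m * F (z + t *\<^sub>R (x - z)) b) *\<^sub>R Blinfun (\<lambda>v. v \<bullet> b))" for x t
  have G: "G x t v = t ^ Suc m * F (z + t *\<^sub>R (x - z)) v"
    if "x \<in> ball z r" "t \<in> {0..1}" for x t v
  proof -
    have "linear (F (z + t *\<^sub>R (x - z)))"
      using df[OF radial_in_ball[OF that]] by (rule has_derivative_linear)
    from resolves_identity_linear[OF B this, of v] show ?thesis
      by (simp add: G_def blinfun.sum_left blinfun.scaleR_left bounded_linear_Blinfun_apply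
          bounded_linear_inner_left sum_distrib_left mult_ac)
  qed
  have contG: "continuous_on (ball z r \<times> cbox 0 1) (\<lambda>(x, t). G x t)"
    unfolding G_def case_prod_beta using radial_in_ball[where z=z and r=r]
    by (intro continuous_intros continuous_on_compose2[OF contF]) (auto simp del: mem_ball)
  have contGx: "continuous_on (cbox 0 1) (G x)" if "x \<in> ball z r" for x
  proof -
    have "continuous_on (cbox 0 1) (\<lambda>t. case (x, t) of (x, t) \<Rightarrow> G x t)"
      by (rule continuous_on_compose2[OF contG]) (use that in \<open>auto intro!: continuous_intros\<close>)
    then show ?thesis by simp
  qed
  let ?I = "\<lambda>x. integral (cbox 0 1) (\<lambda>t. t ^ m * f (z + t *\<^sub>R (x - z)))"
  have "(?I has_derivative (\<lambda>v. integral (cbox 0 1) (\<lambda>t. t ^ Suc m * F (z + t *\<^sub>R (x - z)) v))) (at x)"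
    if x: "x \<in> ball z r" for x
  proof -
    have "(?I has_derivative integral (cbox 0 1) (G x)) (at x within ball z r)"
    proof (rule leibniz_rule[OF _ _ contG x])
      show "((\<lambda>x. t ^ m * f (z + t *\<^sub>R (x - z))) has_derivative G y t) (at y within ball z r)"
        if "y \<in> ball z r" "t \<in> cbox 0 1" for y t
      proof (rule has_derivative_at_withinI)
        have t: "t \<in> {0..1}" using that by simp
        have d: "(f has_derivative F (z + t *\<^sub>R (y - z))) (at (z + t *\<^sub>R (y - z)))"
          by (rule df[OF radial_in_ball[OF that(1) t]])
        have "((\<lambda>x. z + t *\<^sub>R (x - z)) has_derivative (\<lambda>v. t *\<^sub>R v)) (at y)"
          by (auto intro!: derivative_eq_intros)
        note has_derivative_mult_right[OF has_derivative_compose[OF this d], of "t ^ m"]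
        moreover have "blinfun_apply (G y t) = (\<lambda>v. t ^ m * F (z + t *\<^sub>R (y - z)) (t *\<^sub>R v))"
          using linear_cmul[OF has_derivative_linear[OF d]] G[OF that(1) t]
          by (auto simp: fun_eq_iff)
        ultimately show "((\<lambda>x. t ^ m * f (z + t *\<^sub>R (x - z))) has_derivative G y t) (at y)"
          by simp
      qed
      show "(\<lambda>t. t ^ m * f (z + t *\<^sub>R (y - z))) integrable_on cbox 0 1" if "y \<in> ball z r" for y
        using radial_in_ball[OF that]
        by (intro integrable_continuous continuous_intros
            continuous_on_compose2[OF Ck_on_imp_continuous_on[OF Suc.prems]]) auto
    qed (rule convex_ball)
    moreover have "blinfun_apply (integral (cbox 0 1) (G x)) =
        (\<lambda>v. integral (cbox 0 1) (\<lambda>t. t ^ Suc m * F (z + t *\<^sub>R (x - z)) v))"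
    proof
      fix v
      have "integral (cbox 0 1) ((\<lambda>L. blinfun_apply L v) \<circ> G x) =
          blinfun_apply (integral (cbox 0 1) (G x)) v"
        by (intro integral_linear integrable_continuous contGx x blinfun.bounded_linear_left)
      moreover have "integral (cbox 0 1) ((\<lambda>L. blinfun_apply L v) \<circ> G x) =
          integral (cbox 0 1) (\<lambda>t. t ^ Suc m * F (z + t *\<^sub>R (x - z)) v)"
        using G[OF x] by (intro integral_cong) auto
      ultimately show "blinfun_apply (integral (cbox 0 1) (G x)) v =
          integral (cbox 0 1) (\<lambda>t. t ^ Suc m * F (z + t *\<^sub>R (x - z)) v)" by simp
    qed
    ultimately show ?thesis
      using x by (simp add: at_within_open[OF x open_ball])
  qed
  moreover have "Ck_on k (ball z r)
      (\<lambda>x. integral (cbox 0 1) (\<lambda>t. t ^ Suc m * F (z + t *\<^sub>R (x - z)) v))" for v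
    using Suc.prems unfolding F_def by (intro Suc.IH) simp
  ultimately show ?case by (intro Ck_on_SucI[OF open_ball])
qed

text \<open>
  Hadamard's lemma, from the fundamental theorem of calculus along the segment from \<open>z\<close> to
  \<open>x\<close>.
\<close>

lemma smooth_on_radial_expansion:
  fixes f :: "'a::{real_inner,banach} \<Rightarrow> real"
  assumes B: "resolves_identity (B :: 'a set)" and f: "smooth_on (ball z r) f"
  obtains g where "\<And>b. smooth_on (ball z r) (g b)"
    and "\<And>x. x \<in> ball z r \<Longrightarrow> f x = f z + (\<Sum>b\<in>B. ((x - z) \<bullet> b) * g b x)"
    and "\<And>b. g b z = frechet_derivative f (at z) b"
proof
  define F where "F x v = frechet_derivative f (at x) v" for x v
  define g where "g b x = integral (cbox 0 1) (\<lambda>t. t ^ 0 * F (z + t *\<^sub>R (x - z)) b)" for b x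
  have F: "Ck_on k (ball z r) (\<lambda>x. F x v)" for v k
    unfolding F_def using f by (intro Ck_on_Suc_derivative) (simp add: smooth_on_def del: Ck_on.simps)
  show "smooth_on (ball z r) (g b)" for b
    using Ck_on_radial_integral[OF B F] unfolding smooth_on_def g_def by blast
  show "g b z = frechet_derivative f (at z) b" for b
    by (simp add: g_def F_def)
  fix x assume x: "x \<in> ball z r"
  have df: "(f has_derivative F y) (at y)" if "y \<in> ball z r" for y
    unfolding F_def using Ck_on_Suc_has_derivative[of 0] f that smooth_on_def by blast
  have "((\<lambda>t. F (z + t *\<^sub>R (x - z)) (x - z)) has_integral
      f (z + 1 *\<^sub>R (x - z)) - f (z + 0 *\<^sub>R (x - z))) {0..1}"
  proof (rule fundamental_theorem_of_calculus)
    fix t :: real assume t: "t \<in> {0..1}"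
    have d: "(f has_derivative F (z + t *\<^sub>R (x - z))) (at (z + t *\<^sub>R (x - z)))"
      by (rule df[OF radial_in_ball[OF x t]])
    have "((\<lambda>t. z + t *\<^sub>R (x - z)) has_derivative (\<lambda>s. s *\<^sub>R (x - z))) (at t)"
      by (auto intro!: derivative_eq_intros)
    from has_derivative_compose[OF this d]
    have "((\<lambda>t. f (z + t *\<^sub>R (x - z))) has_vector_derivative F (z + t *\<^sub>R (x - z)) (x - z)) (at t)"
      using linear_cmul[OF has_derivative_linear[OF d]] by (simp add: has_vector_derivative_def)
    then show "((\<lambda>t. f (z + t *\<^sub>R (x - z))) has_vector_derivative F (z + t *\<^sub>R (x - z)) (x - z)) (at t within {0..1})"
      by (rule has_vector_derivative_at_within)
  qed simp
  then have "f x - f z = integral {0..1} (\<lambda>t. F (z + t *\<^sub>R (x - z)) (x - z))"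
    by (simp add: integral_unique)
  also have "\<dots> = integral {0..1} (\<lambda>t. \<Sum>b\<in>B. ((x - z) \<bullet> b) * F (z + t *\<^sub>R (x - z)) b)"
    using resolves_identity_linear[OF B has_derivative_linear[OF df[OF radial_in_ball[OF x]]], of _ "x - z"]
    by (intro integral_cong) simp
  also have "\<dots> = (\<Sum>b\<in>B. integral {0..1} (\<lambda>t. ((x - z) \<bullet> b) * F (z + t *\<^sub>R (x - z)) b))"
  proof (rule integral_sum)
    show "finite B" using B by (simp add: resolves_identity_def)
    show "(\<lambda>t. ((x - z) \<bullet> b) * F (z + t *\<^sub>R (x - z)) b) integrable_on {0..1}" for b
      using radial_in_ball[OF x]
      by (intro integrable_continuous_interval continuous_intros
            continuous_on_compose2[OF Ck_on_imp_continuous_on[OF F]]) auto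
  qed
  also have "\<dots> = (\<Sum>b\<in>B. ((x - z) \<bullet> b) * g b x)"
    by (simp add: g_def)
  finally show "f x = f z + (\<Sum>b\<in>B. ((x - z) \<bullet> b) * g b x)" by simp
qed

lemma smooth_on_subset: "smooth_on S f \<Longrightarrow> T \<subseteq> S \<Longrightarrow> smooth_on T f"
  unfolding smooth_on_def using Ck_on_subset by blast

lemma smooth_on_cong: "open S \<Longrightarrow> (\<And>x. x \<in> S \<Longrightarrow> f x = g x) \<Longrightarrow> smooth_on S f \<Longrightarrow> smooth_on S g"
  using Ck_on_cong by (metis smooth_on_def)

lemma smooth_on_local:
  assumes "\<And>x. x \<in> S \<Longrightarrow> \<exists>T. open T \<and> x \<in> T \<and> smooth_on T f"
  shows "smooth_on S f"
  unfolding smooth_on_def by (intro allI Ck_on_local) (metis assms smooth_on_def)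

lemma smooth_on_const: "smooth_on S (\<lambda>x. c)"
  by (simp add: smooth_on_def Ck_on_const)

lemma smooth_on_ident: "open S \<Longrightarrow> smooth_on S (\<lambda>x. x)"
  by (simp add: smooth_on_def Ck_on_ident)

lemma smooth_on_bounded_linear: "bounded_linear L \<Longrightarrow> open S \<Longrightarrow> smooth_on S L"
  by (simp add: smooth_on_def Ck_on_bounded_linear)

lemma smooth_on_add: "open S \<Longrightarrow> smooth_on S f \<Longrightarrow> smooth_on S g \<Longrightarrow> smooth_on S (\<lambda>x. f x + g x)"
  by (simp add: smooth_on_def Ck_on_add)

lemma smooth_on_mult:
  fixes f g :: "'a::real_normed_vector \<Rightarrow> real"
  shows "open S \<Longrightarrow> smooth_on S f \<Longrightarrow> smooth_on S g \<Longrightarrow> smooth_on S (\<lambda>x. f x * g x)"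
  by (simp add: smooth_on_def Ck_on_bilinear[OF bounded_bilinear_mult])

lemma smooth_on_comp:
  fixes f :: "'a::real_normed_vector \<Rightarrow> 'b::real_inner" and g :: "'b \<Rightarrow> 'c::real_normed_vector"
  assumes "resolves_identity (B :: 'b set)"
    and "open S" "open T" "f ` S \<subseteq> T" "smooth_on S f" "smooth_on T g"
  shows "smooth_on S (\<lambda>x. g (f x))"
  using Ck_on_comp[OF assms(1-4)] assms(5,6) unfolding smooth_on_def by blast

lemma smooth_on_Pair:
  "open S \<Longrightarrow> smooth_on S f \<Longrightarrow> smooth_on S g \<Longrightarrow> smooth_on S (\<lambda>x. (f x, g x))"
  by (simp add: smooth_on_def Ck_on_Pair)

lemma smooth_on_derivative: "smooth_on S f \<Longrightarrow> smooth_on S (\<lambda>x. frechet_derivative f (at x) v)"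
  unfolding smooth_on_def using Ck_on_Suc_derivative by blast

lemma smooth_on_has_derivative:
  "smooth_on S f \<Longrightarrow> x \<in> S \<Longrightarrow> (f has_derivative frechet_derivative f (at x)) (at x)"
  unfolding smooth_on_def by (intro Ck_on_Suc_has_derivative[where k=0]) auto

lemma frechet_derivative_second_argument:
  assumes "smooth_on N k" "(x, y) \<in> N"
  shows "frechet_derivative (\<lambda>y. k (x, y)) (at y) c = frechet_derivative k (at (x, y)) (0, c)"
proof -
  have "((\<lambda>y. (x, y)) has_derivative (\<lambda>c. (0, c))) (at y)"
    by (auto intro!: derivative_eq_intros)
  from has_derivative_compose[OF this smooth_on_has_derivative[OF assms]]
  show ?thesis using frechet_derivative_at by metis
qed

lemma frechet_derivative_first_argument:
  assumes "smooth_on N k" "(x, y) \<in> N"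
  shows "frechet_derivative (\<lambda>x. k (x, y)) (at x) c = frechet_derivative k (at (x, y)) (c, 0)"
proof -
  have "((\<lambda>x. (x, y)) has_derivative (\<lambda>c. (c, 0))) (at x)"
    by (auto intro!: derivative_eq_intros)
  from has_derivative_compose[OF this smooth_on_has_derivative[OF assms]]
  show ?thesis using frechet_derivative_at by metis
qed

text \<open>
  The partial derivatives are the derivatives in the directions \<open>(a, 0)\<close> and \<open>(0, c)\<close>.
\<close>

lemma mixed_partials_commute:
  fixes k :: "'a::real_normed_vector \<times> 'b::real_normed_vector \<Rightarrow> real"
  assumes "open N" "smooth_on N k" "(x0, y0) \<in> N"
  shows "frechet_derivative (\<lambda>x. frechet_derivative (\<lambda>y. k (x, y)) (at y0) c) (at x0) a =
    frechet_derivative (\<lambda>y. frechet_derivative (\<lambda>x. k (x, y)) (at x0) a) (at y0) c"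
proof -
  let ?k1 = "\<lambda>p. frechet_derivative k (at p) (a, 0)" and ?k2 = "\<lambda>p. frechet_derivative k (at p) (0, c)"
  have k: "smooth_on N ?k1" "smooth_on N ?k2"
    using assms(2) by (simp_all add: smooth_on_derivative)
  have "frechet_derivative (\<lambda>x. frechet_derivative (\<lambda>y. k (x, y)) (at y0) c) (at x0) =
     frechet_derivative (\<lambda>x. ?k2 (x, y0)) (at x0)"
  proof (rule frechet_derivative_transform_within_open[symmetric])
    show "open ((\<lambda>x. (x, y0)) -` N)"
      using assms(1) by (auto intro!: open_vimage continuous_intros)
    have "((\<lambda>x. (x, y0)) has_derivative (\<lambda>c. (c, 0))) (at x0)"
      by (auto intro!: derivative_eq_intros)
    from has_derivative_compose[OF this smooth_on_has_derivative[OF k(2) assms(3)]]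
    show "(\<lambda>x. ?k2 (x, y0)) differentiable at x0" by (auto simp: differentiable_def)
  qed (use assms frechet_derivative_second_argument[OF assms(2)] in auto)
  moreover have "frechet_derivative (\<lambda>y. frechet_derivative (\<lambda>x. k (x, y)) (at x0) a) (at y0) =
     frechet_derivative (\<lambda>y. ?k1 (x0, y)) (at y0)"
  proof (rule frechet_derivative_transform_within_open[symmetric])
    show "open ((\<lambda>y. (x0, y)) -` N)"
      using assms(1) by (auto intro!: open_vimage continuous_intros)
    have "((\<lambda>y. (x0, y)) has_derivative (\<lambda>c. (0, c))) (at y0)"
      by (auto intro!: derivative_eq_intros)
    from has_derivative_compose[OF this smooth_on_has_derivative[OF k(1) assms(3)]]
    show "(\<lambda>y. ?k1 (x0, y)) differentiable at y0" by (auto simp: differentiable_def)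
  qed (use assms frechet_derivative_first_argument[OF assms(2)] in auto)
  ultimately show ?thesis
    using frechet_derivative_first_argument[OF k(2) assms(3)]
      frechet_derivative_second_argument[OF k(1) assms(3)]
      second_derivative_symmetric[OF assms(1,3), of k "(0, c)" "(a, 0)"] assms(2)
    by (simp add: smooth_on_def)
qed


section \<open>Functions on manifolds\<close>

locale manifold =
  fixes A :: "('m::{t2_space,second_countable_topology}, 'e::{real_inner,banach}) atlas"
  assumes smooth_manifold: "smooth_manifold A"
begin

lemma resolution:
  obtains B :: "'e set" where "resolves_identity B"
  using smooth_manifold resolves_identity_exists unfolding smooth_manifold_def by metis

lemma is_chart: "(U, \<phi>) \<in> A \<Longrightarrow> chart U \<phi>"
  using smooth_manifold unfolding smooth_manifold_def by auto

lemma chart_at: obtains U \<phi> where "(U, \<phi>) \<in> A" "p \<in> U"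
  using smooth_manifold unfolding smooth_manifold_def by blast

lemma chart_open: "(U, \<phi>) \<in> A \<Longrightarrow> open U"
  using is_chart by (auto simp: chart_def)

lemma chart_inverse: "(U, \<phi>) \<in> A \<Longrightarrow> p \<in> U \<Longrightarrow> inv_into U \<phi> (\<phi> p) = p"
  using is_chart by (auto simp: chart_def homeomorphism_def)

lemma chart_image_open:
  assumes "(U, \<phi>) \<in> A" "open W"
  shows "open (\<phi> ` (U \<inter> W))"
proof -
  have c: "open U" "open (\<phi> ` U)" "homeomorphism U (\<phi> ` U) \<phi> (inv_into U \<phi>)"
    using is_chart[OF assms(1)] by (auto simp: chart_def)
  have "openin (top_of_set (\<phi> ` U)) (\<phi> ` (U \<inter> W))"
    using assms(2) by (intro homeomorphism_imp_open_map[OF c(3)]) (auto simp: openin_open)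
  then show ?thesis using c(2) openin_open_trans by blast
qed

lemma chart_vimage_open:
  assumes "(U, \<phi>) \<in> A" "open T"
  shows "open (U \<inter> \<phi> -` T)"
  using is_chart[OF assms(1)] assms(2)
  by (auto simp: chart_def homeomorphism_def continuous_on_open_vimage Int_commute)

lemma transition_smooth:
  "(U, \<phi>) \<in> A \<Longrightarrow> (V, \<psi>) \<in> A \<Longrightarrow> smooth_on (\<phi> ` (U \<inter> V)) (\<psi> \<circ> inv_into U \<phi>)"
  using smooth_manifold unfolding smooth_manifold_def by blast

lemma smooth_fun_on_iff_smooth_near:
  assumes "open W"
  shows "smooth_fun_on A W f \<longleftrightarrow> (\<forall>p\<in>W. smooth_near A p f)"
proof
  assume *: "\<forall>p\<in>W. smooth_near A p f"
  have "smooth_on (\<phi> ` (U \<inter> W)) (f \<circ> inv_into U \<phi>)" if U: "(U, \<phi>) \<in> A" for U \<phi>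
  proof (rule smooth_on_local)
    fix x assume "x \<in> \<phi> ` (U \<inter> W)"
    then obtain p where p: "x = \<phi> p" "p \<in> U" "p \<in> W" by auto
    with * obtain W' where "open W'" "p \<in> W'" "smooth_fun_on A W' f"
      by (auto simp: smooth_near_def)
    with p U show "\<exists>T. open T \<and> x \<in> T \<and> smooth_on T (f \<circ> inv_into U \<phi>)"
      by (intro exI[of _ "\<phi> ` (U \<inter> W')"]) (auto simp: smooth_fun_on_def chart_image_open)
  qed
  then show "smooth_fun_on A W f" by (auto simp: smooth_fun_on_def)
qed (use assms in \<open>auto simp: smooth_near_def\<close>)

text \<open>
  Smoothness in one chart implies smoothness in every other one by composition with the smooth
  transition map.
\<close>

lemma smooth_near_iff_chart:
  assumes U: "(U, \<phi>) \<in> A" "p \<in> U"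
  shows "smooth_near A p f \<longleftrightarrow>
    (\<exists>T. open T \<and> \<phi> p \<in> T \<and> T \<subseteq> \<phi> ` U \<and> smooth_on T (f \<circ> inv_into U \<phi>))"
proof
  assume "smooth_near A p f"
  then obtain W where "open W" "p \<in> W" "smooth_fun_on A W f" by (auto simp: smooth_near_def)
  with U show "\<exists>T. open T \<and> \<phi> p \<in> T \<and> T \<subseteq> \<phi> ` U \<and> smooth_on T (f \<circ> inv_into U \<phi>)"
    by (intro exI[of _ "\<phi> ` (U \<inter> W)"]) (auto simp: smooth_fun_on_def chart_image_open)
next
  assume "\<exists>T. open T \<and> \<phi> p \<in> T \<and> T \<subseteq> \<phi> ` U \<and> smooth_on T (f \<circ> inv_into U \<phi>)"
  then obtain T where T: "open T" "\<phi> p \<in> T" "T \<subseteq> \<phi> ` U" "smooth_on T (f \<circ> inv_into U \<phi>)"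
    by blast
  let ?W = "U \<inter> \<phi> -` T"
  obtain B :: "'e set" where B: "resolves_identity B" by (rule resolution)
  have W: "open ?W" using U T by (intro chart_vimage_open)
  have "smooth_on (\<psi> ` (V \<inter> ?W)) (f \<circ> inv_into V \<psi>)" if V: "(V, \<psi>) \<in> A" for V \<psi>
  proof -
    have o: "open (\<psi> ` (V \<inter> ?W))" using V W by (rule chart_image_open)
    have t: "smooth_on (\<psi> ` (V \<inter> ?W)) (\<phi> \<circ> inv_into V \<psi>)"
      using transition_smooth[OF V U(1)] by (rule smooth_on_subset) auto
    have "(\<phi> \<circ> inv_into V \<psi>) ` \<psi> ` (V \<inter> ?W) \<subseteq> T"
      using chart_inverse[OF V] by auto
    from smooth_on_comp[OF B o T(1) this t T(4)]
    have "smooth_on (\<psi> ` (V \<inter> ?W)) (\<lambda>y. (f \<circ> inv_into U \<phi>) ((\<phi> \<circ> inv_into V \<psi>) y))" .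
    then show ?thesis
      by (rule smooth_on_cong[OF o, rotated]) (use chart_inverse[OF V] chart_inverse[OF U(1)] in auto)
  qed
  then have "smooth_fun_on A ?W f" by (auto simp: smooth_fun_on_def)
  then show "smooth_near A p f"
    using W U T by (auto simp: smooth_near_def)
qed

lemma smooth_near_cong:
  assumes "smooth_near A p f" "\<forall>\<^sub>F q in nhds p. f q = g q"
  shows "smooth_near A p g"
proof -
  obtain U \<phi> where U: "(U, \<phi>) \<in> A" "p \<in> U" by (rule chart_at)
  obtain T where T: "open T" "\<phi> p \<in> T" "T \<subseteq> \<phi> ` U" "smooth_on T (f \<circ> inv_into U \<phi>)"
    using assms(1) by (auto simp: smooth_near_iff_chart[OF U])
  obtain W where W: "open W" "p \<in> W" "\<And>q. q \<in> W \<Longrightarrow> f q = g q"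
    using assms(2) by (auto simp: eventually_nhds)
  let ?T = "T \<inter> \<phi> ` (U \<inter> W)"
  have "open ?T" using T(1) chart_image_open[OF U(1) W(1)] by blast
  moreover have "smooth_on ?T (g \<circ> inv_into U \<phi>)"
    by (rule smooth_on_cong[OF \<open>open ?T\<close> _ smooth_on_subset[OF T(4)]])
      (use W(3) chart_inverse[OF U(1)] in auto)
  ultimately show ?thesis
    using U W T by (auto simp: smooth_near_iff_chart[OF U])
qed

lemma smooth_near_const: "smooth_near A p (\<lambda>q. c)"
  by (auto simp: smooth_near_def smooth_fun_on_def comp_def smooth_on_const intro!: exI[of _ UNIV])

lemma smooth_near_binop:
  assumes f: "smooth_near A p f" and g: "smooth_near A p g"
    and "\<And>S f g. open (S :: 'e set) \<Longrightarrow> smooth_on S f \<Longrightarrow> smooth_on S g \<Longrightarrow> smooth_on S (\<lambda>x. m (f x) (g x))"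
  shows "smooth_near A p (\<lambda>q. m (f q) (g q))"
proof -
  obtain U \<phi> where U: "(U, \<phi>) \<in> A" "p \<in> U" by (rule chart_at)
  obtain T where T: "open T" "\<phi> p \<in> T" "T \<subseteq> \<phi> ` U" "smooth_on T (f \<circ> inv_into U \<phi>)"
    using f by (auto simp: smooth_near_iff_chart[OF U])
  obtain T' where T': "open T'" "\<phi> p \<in> T'" "T' \<subseteq> \<phi> ` U" "smooth_on T' (g \<circ> inv_into U \<phi>)"
    using g by (auto simp: smooth_near_iff_chart[OF U])
  have "smooth_on (T \<inter> T') (\<lambda>x. m ((f \<circ> inv_into U \<phi>) x) ((g \<circ> inv_into U \<phi>) x))"
    by (intro assms(3) smooth_on_subset[OF T(4)] smooth_on_subset[OF T'(4)]) (use T T' in auto)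
  with T T' show ?thesis
    unfolding smooth_near_iff_chart[OF U] by (intro exI[of _ "T \<inter> T'"]) (auto simp: comp_def)
qed

lemma smooth_near_add:
  "smooth_near A p f \<Longrightarrow> smooth_near A p g \<Longrightarrow> smooth_near A p (\<lambda>q. f q + g q)"
  by (rule smooth_near_binop) (auto intro: smooth_on_add)

lemma smooth_near_mult:
  "smooth_near A p f \<Longrightarrow> smooth_near A p g \<Longrightarrow> smooth_near A p (\<lambda>q. f q * g q)"
  by (rule smooth_near_binop) (auto intro: smooth_on_mult)

lemma smooth_near_diff:
  assumes "smooth_near A p f" "smooth_near A p g"
  shows "smooth_near A p (\<lambda>q. f q - g q)"
  using smooth_near_add[OF assms(1) smooth_near_mult[OF smooth_near_const[of p "-1"] assms(2)]] by simp

lemma smooth_near_sum: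
  "(\<And>j. j \<in> I \<Longrightarrow> smooth_near A p (f j)) \<Longrightarrow> smooth_near A p (\<lambda>q. \<Sum>j\<in>I. f j q)"
  by (induction I rule: infinite_finite_induct) (auto intro: smooth_near_const smooth_near_add)

lemma smooth_near_chart_comp:
  assumes U: "(U, \<phi>) \<in> A" "p \<in> U" and T: "open T" "\<phi> p \<in> T" "smooth_on T g"
  shows "smooth_near A p (\<lambda>q. g (\<phi> q))"
  unfolding smooth_near_iff_chart[OF U]
proof (intro exI conjI)
  let ?T = "T \<inter> \<phi> ` U"
  show "open ?T" using T(1) chart_image_open[OF U(1) open_UNIV] by auto
  show "smooth_on ?T ((\<lambda>q. g (\<phi> q)) \<circ> inv_into U \<phi>)"
    by (rule smooth_on_cong[OF \<open>open ?T\<close> _ smooth_on_subset[OF T(3)]])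
      (use chart_inverse[OF U(1)] in auto)
qed (use U T in auto)

lemma smooth_near_coordinate:
  "(U, \<phi>) \<in> A \<Longrightarrow> p \<in> U \<Longrightarrow> smooth_near A p (\<lambda>q. \<phi> q \<bullet> b)"
  by (rule smooth_near_chart_comp[of U \<phi> p UNIV])
    (auto intro!: smooth_on_bounded_linear bounded_linear_inner_left)


section \<open>Tangent vectors\<close>

context
  fixes p v assumes v: "v \<in> tangent_space A p"
begin

lemma tangent_not_smooth: "\<not> smooth_near A p f \<Longrightarrow> v f = 0"
  and tangent_add: "smooth_near A p f \<Longrightarrow> smooth_near A p g \<Longrightarrow> v (\<lambda>q. f q + g q) = v f + v g"
  and tangent_mult: "smooth_near A p f \<Longrightarrow> smooth_near A p g \<Longrightarrow>
    v (\<lambda>q. f q * g q) = f p * v g + g p * v f"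
  and tangent_scale: "smooth_near A p f \<Longrightarrow> v (\<lambda>q. c * f q) = c * v f"
  using v by (auto simp: tangent_space_def)

lemma tangent_const: "v (\<lambda>q. c) = 0"
proof -
  have "v (\<lambda>q. 1 * 1) = 1 * v (\<lambda>q. 1) + 1 * v (\<lambda>q. 1)"
    by (intro tangent_mult smooth_near_const)
  then show ?thesis
    using tangent_scale[OF smooth_near_const[of p 1], of c] by simp
qed

lemma tangent_diff:
  assumes "smooth_near A p f" "smooth_near A p g"
  shows "v (\<lambda>q. f q - g q) = v f - v g"
proof -
  have "v (\<lambda>q. (f q - g q) + g q) = v (\<lambda>q. f q - g q) + v g"
    by (intro tangent_add smooth_near_diff assms)
  then show ?thesis by simp
qed

lemma tangent_sum:
  "(\<And>j. j \<in> I \<Longrightarrow> smooth_near A p (f j)) \<Longrightarrow> v (\<lambda>q. \<Sum>j\<in>I. f j q) = (\<Sum>j\<in>I. v (f j))"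
  by (induction I rule: infinite_finite_induct)
    (auto simp: tangent_const tangent_add smooth_near_sum)

text \<open>
  If \<open>f\<close> and \<open>g\<close> agree on \<open>W\<close>, then the indicator function of \<open>W\<close> annihilates \<open>f - g\<close> everywhere.  It
  is smooth near \<open>p\<close>, being constant there, so the product rule applies to this product
  and identifies \<open>v f - v g\<close> with the derivative of 0.
\<close>

lemma tangent_local:
  assumes "\<forall>\<^sub>F q in nhds p. f q = g q"
  shows "v f = v g"
proof (cases "smooth_near A p f")
  case True
  then have g: "smooth_near A p g" using assms by (rule smooth_near_cong)
  obtain W where W: "open W" "p \<in> W" "\<And>q. q \<in> W \<Longrightarrow> f q = g q"
    using assms by (auto simp: eventually_nhds)
  define u :: "'m \<Rightarrow> real" where "u = indicator W"
  have "\<forall>\<^sub>F q in nhds p. 1 = u q"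
    using W by (auto simp: eventually_nhds u_def)
  with smooth_near_const have u: "smooth_near A p u" by (rule smooth_near_cong)
  have "(\<lambda>q. u q * (f q - g q)) = (\<lambda>q. 0)"
    using W(3) by (auto simp: u_def indicator_def)
  then have "0 = v (\<lambda>q. u q * (f q - g q))" by (simp add: tangent_const)
  also have "\<dots> = u p * v (\<lambda>q. f q - g q) + (f p - g p) * v u"
    by (intro tangent_mult u smooth_near_diff True g)
  also have "\<dots> = v f - v g"
    using W by (simp add: u_def tangent_diff True g)
  finally show ?thesis by simp
next
  case False
  moreover have "\<not> smooth_near A p g"
  proof
    assume g: "smooth_near A p g"
    have "\<forall>\<^sub>F q in nhds p. g q = f q" using assms by eventually_elim simp
    from smooth_near_cong[OF g this] False show False by simp
  qed
  ultimately show ?thesis by (simp add: tangent_not_smooth)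
qed

text \<open>
  Hadamard's lemma writes \<open>f\<close> near \<open>p\<close> as a constant plus a sum of products, one factor of each being
  a coordinate function centred at \<open>p\<close>.  On such a product only the derivative of the vanishing
  factor survives.
\<close>

lemma tangent_eq_directional_derivative:
  assumes B: "resolves_identity B" and U: "(U, \<phi>) \<in> A" "p \<in> U" and f: "smooth_near A p f"
  shows "v f = frechet_derivative (f \<circ> inv_into U \<phi>) (at (\<phi> p)) (\<Sum>b\<in>B. v (\<lambda>q. \<phi> q \<bullet> b) *\<^sub>R b)"
    and "v f = (\<Sum>b\<in>B. v (\<lambda>q. \<phi> q \<bullet> b) * frechet_derivative (f \<circ> inv_into U \<phi>) (at (\<phi> p)) b)"
proof -
  let ?f = "f \<circ> inv_into U \<phi>"
  obtain T where T: "open T" "\<phi> p \<in> T" "T \<subseteq> \<phi> ` U" "smooth_on T ?f"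
    using f by (auto simp: smooth_near_iff_chart[OF U])
  obtain r where r: "r > 0" "ball (\<phi> p) r \<subseteq> T"
    using T by (meson open_contains_ball)
  obtain g where g: "\<And>b. smooth_on (ball (\<phi> p) r) (g b)"
    "\<And>x. x \<in> ball (\<phi> p) r \<Longrightarrow> ?f x = ?f (\<phi> p) + (\<Sum>b\<in>B. ((x - \<phi> p) \<bullet> b) * g b x)"
    "\<And>b. g b (\<phi> p) = frechet_derivative ?f (at (\<phi> p)) b"
    using smooth_on_radial_expansion[OF B smooth_on_subset[OF T(4) r(2)]] by blast
  have g_near: "smooth_near A p (\<lambda>q. g b (\<phi> q))" for b
    using r by (intro smooth_near_chart_comp[OF U open_ball _ g(1)]) auto
  have x_near: "smooth_near A p (\<lambda>q. \<phi> q \<bullet> b - \<phi> p \<bullet> b)" for b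
    by (intro smooth_near_diff smooth_near_coordinate[OF U] smooth_near_const)
  have "\<forall>\<^sub>F q in nhds p. f q = f p + (\<Sum>b\<in>B. (\<phi> q \<bullet> b - \<phi> p \<bullet> b) * g b (\<phi> q))"
    unfolding eventually_nhds
  proof (intro exI conjI ballI)
    show "open (U \<inter> \<phi> -` ball (\<phi> p) r)" using U by (intro chart_vimage_open) auto
    show "f q = f p + (\<Sum>b\<in>B. (\<phi> q \<bullet> b - \<phi> p \<bullet> b) * g b (\<phi> q))" if "q \<in> U \<inter> \<phi> -` ball (\<phi> p) r" for q
      using g(2)[of "\<phi> q"] that U chart_inverse[OF U(1)] by (simp add: inner_diff_left)
  qed (use U r in auto)
  then have "v f = v (\<lambda>q. f p + (\<Sum>b\<in>B. (\<phi> q \<bullet> b - \<phi> p \<bullet> b) * g b (\<phi> q)))"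
    by (rule tangent_local)
  also have "\<dots> = (\<Sum>b\<in>B. v (\<lambda>q. (\<phi> q \<bullet> b - \<phi> p \<bullet> b) * g b (\<phi> q)))"
    by (simp add: tangent_add tangent_sum tangent_const smooth_near_const smooth_near_sum
        smooth_near_mult g_near x_near)
  also have "\<dots> = (\<Sum>b\<in>B. v (\<lambda>q. \<phi> q \<bullet> b) * frechet_derivative ?f (at (\<phi> p)) b)"
    by (simp add: tangent_mult g_near x_near tangent_diff smooth_near_coordinate[OF U]
        smooth_near_const tangent_const g(3) mult.commute)
  finally show *: "v f = (\<Sum>b\<in>B. v (\<lambda>q. \<phi> q \<bullet> b) * frechet_derivative ?f (at (\<phi> p)) b)" .
  have "linear (frechet_derivative ?f (at (\<phi> p)))"
    by (rule has_derivative_linear[OF smooth_on_has_derivative[OF T(4,2)]])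
  with * show "v f = frechet_derivative ?f (at (\<phi> p)) (\<Sum>b\<in>B. v (\<lambda>q. \<phi> q \<bullet> b) *\<^sub>R b)"
    by (simp add: linear_sum linear_cmul)
qed

end

lemma tangentI:
  assumes "\<And>f. \<not> smooth_near A p f \<Longrightarrow> v f = 0"
    and "\<And>f g. smooth_near A p f \<Longrightarrow> smooth_near A p g \<Longrightarrow> v (\<lambda>q. f q + g q) = v f + v g"
    and "\<And>f g. smooth_near A p f \<Longrightarrow> smooth_near A p g \<Longrightarrow> v (\<lambda>q. f q * g q) = f p * v g + g p * v f"
    and "\<And>c f. smooth_near A p f \<Longrightarrow> v (\<lambda>q. c * f q) = c * v f"
  shows "v \<in> tangent_space A p"
  unfolding tangent_space_def using assms by blast

lemma tangent_chart_comp: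
  assumes v: "v \<in> tangent_space A p" and B: "resolves_identity B" and U: "(U, \<phi>) \<in> A" "p \<in> U"
    and T: "open T" "\<phi> p \<in> T" "smooth_on T g"
  shows "v (\<lambda>q. g (\<phi> q)) = frechet_derivative g (at (\<phi> p)) (\<Sum>b\<in>B. v (\<lambda>q. \<phi> q \<bullet> b) *\<^sub>R b)"
proof -
  have "frechet_derivative g (at (\<phi> p)) = frechet_derivative ((\<lambda>q. g (\<phi> q)) \<circ> inv_into U \<phi>) (at (\<phi> p))"
  proof (rule frechet_derivative_transform_within_open)
    show "g differentiable at (\<phi> p)"
      using smooth_on_has_derivative[OF T(3,2)] by (auto simp: differentiable_def)
    show "open (\<phi> ` (U \<inter> UNIV))" by (rule chart_image_open[OF U(1) open_UNIV])
  qed (use U chart_inverse[OF U(1)] in auto)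
  then show ?thesis
    using tangent_eq_directional_derivative(1)[OF v B U smooth_near_chart_comp[OF U T]] by simp
qed

text \<open>
  The directional derivative along \<open>w\<close> in the chart \<open>\<phi>\<close>, normalised to be a tangent vector.
\<close>

definition coordinate_vector :: "'m set \<Rightarrow> ('m \<Rightarrow> 'e) \<Rightarrow> 'm \<Rightarrow> 'e \<Rightarrow> ('m \<Rightarrow> real) \<Rightarrow> real" where
  "coordinate_vector U \<phi> p w f =
     (if smooth_near A p f then frechet_derivative (f \<circ> inv_into U \<phi>) (at (\<phi> p)) w else 0)"

lemma coordinate_vector_tangent:
  assumes U: "(U, \<phi>) \<in> A" "p \<in> U"
  shows "coordinate_vector U \<phi> p w \<in> tangent_space A p"
proof -
  have d: "((f \<circ> inv_into U \<phi>) has_derivative frechet_derivative (f \<circ> inv_into U \<phi>) (at (\<phi> p))) (at (\<phi> p))"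
    if "smooth_near A p f" for f
    using that smooth_on_has_derivative unfolding smooth_near_iff_chart[OF U] by blast
  have e: "inv_into U \<phi> (\<phi> p) = p" by (rule chart_inverse[OF U])
  have add: "frechet_derivative ((\<lambda>q. f q + g q) \<circ> inv_into U \<phi>) (at (\<phi> p)) =
      (\<lambda>w. frechet_derivative (f \<circ> inv_into U \<phi>) (at (\<phi> p)) w + frechet_derivative (g \<circ> inv_into U \<phi>) (at (\<phi> p)) w)"
    if "smooth_near A p f" "smooth_near A p g" for f g
    using has_derivative_add[OF d[OF that(1)] d[OF that(2)]]
    by (intro frechet_derivative_at[symmetric]) (simp add: comp_def)
  have mult: "frechet_derivative ((\<lambda>q. f q * g q) \<circ> inv_into U \<phi>) (at (\<phi> p)) =
      (\<lambda>w. f p * frechet_derivative (g \<circ> inv_into U \<phi>) (at (\<phi> p)) w + frechet_derivative (f \<circ> inv_into U \<phi>) (at (\<phi> p)) w * g p)"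
    if "smooth_near A p f" "smooth_near A p g" for f g
    using has_derivative_mult[OF d[OF that(1)] d[OF that(2)]]
    by (intro frechet_derivative_at[symmetric]) (simp add: comp_def e)
  have scale: "frechet_derivative ((\<lambda>q. c * f q) \<circ> inv_into U \<phi>) (at (\<phi> p)) =
      (\<lambda>w. c * frechet_derivative (f \<circ> inv_into U \<phi>) (at (\<phi> p)) w)"
    if "smooth_near A p f" for f c
    using has_derivative_mult_right[OF d[OF that]]
    by (intro frechet_derivative_at[symmetric]) (simp add: comp_def)
  show ?thesis
  proof (rule tangentI)
    fix f g assume fg: "smooth_near A p f" "smooth_near A p g"
    show "coordinate_vector U \<phi> p w (\<lambda>q. f q + g q) =
        coordinate_vector U \<phi> p w f + coordinate_vector U \<phi> p w g"
      using fg by (simp add: coordinate_vector_def smooth_near_add add[OF fg])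
    show "coordinate_vector U \<phi> p w (\<lambda>q. f q * g q) =
        f p * coordinate_vector U \<phi> p w g + g p * coordinate_vector U \<phi> p w f"
      using fg by (simp add: coordinate_vector_def smooth_near_mult mult[OF fg])
  next
    fix c f assume f: "smooth_near A p f"
    show "coordinate_vector U \<phi> p w (\<lambda>q. c * f q) = c * coordinate_vector U \<phi> p w f"
      using f by (simp add: coordinate_vector_def smooth_near_mult smooth_near_const scale[OF f])
  qed (simp add: coordinate_vector_def)
qed


section \<open>Vector fields\<close>

lemma vector_field_tangent: "X \<in> vector_fields A \<Longrightarrow> X p \<in> tangent_space A p"
  by (simp add: vector_fields_def)

lemma vector_field_smooth_near:
  assumes "X \<in> vector_fields A" "smooth_near A p f"
  shows "smooth_near A p (\<lambda>q. X q f)"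
  using assms unfolding smooth_near_def vector_fields_def by blast

lemma vector_fieldI:
  assumes "\<And>p. X p \<in> tangent_space A p"
    and "\<And>p f. smooth_near A p f \<Longrightarrow> smooth_near A p (\<lambda>q. X q f)"
  shows "X \<in> vector_fields A"
  using assms by (auto simp: vector_fields_def smooth_fun_on_iff_smooth_near)

lemma smooth_fun_on_UNIV: "smooth_fun_on A UNIV h \<longleftrightarrow> (\<forall>p. smooth_near A p h)"
  by (simp add: smooth_fun_on_iff_smooth_near)

lemma vf_add_vector_field:
  assumes X: "X \<in> vector_fields A" and Y: "Y \<in> vector_fields A"
  shows "vf_add X Y \<in> vector_fields A"
proof (rule vector_fieldI)
  note simps = tangent_not_smooth tangent_add tangent_mult tangent_scale
  show "vf_add X Y p \<in> tangent_space A p" for p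
    by (rule tangentI) (simp_all add: vf_add_def algebra_simps
      simps[OF vector_field_tangent[OF X]] simps[OF vector_field_tangent[OF Y]])
qed (simp add: vf_add_def smooth_near_add vector_field_smooth_near[OF X] vector_field_smooth_near[OF Y])

lemma vf_scale_vector_field:
  assumes h: "smooth_fun_on A UNIV h" and X: "X \<in> vector_fields A"
  shows "vf_scale h X \<in> vector_fields A"
proof (rule vector_fieldI)
  note simps = tangent_not_smooth tangent_add tangent_mult tangent_scale
  show "vf_scale h X p \<in> tangent_space A p" for p
    by (rule tangentI) (simp_all add: vf_scale_def algebra_simps
      simps[OF vector_field_tangent[OF X]])
qed (use h in \<open>simp add: vf_scale_def smooth_near_mult vector_field_smooth_near[OF X] smooth_fun_on_UNIV\<close>)

lemma zero_vector_field: "(\<lambda>p f. 0) \<in> vector_fields A"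
  by (intro vector_fieldI tangentI smooth_near_const) auto

lemma lie_bracket_antisym: "lie_bracket A Y X p f = - lie_bracket A X Y p f"
  by (simp add: lie_bracket_def)

lemma lie_bracket_add_right:
  assumes "X \<in> vector_fields A" "Y \<in> vector_fields A" "Y' \<in> vector_fields A"
  shows "lie_bracket A X (vf_add Y Y') = vf_add (lie_bracket A X Y) (lie_bracket A X Y')"
  by (intro ext) (simp add: lie_bracket_def vf_add_def tangent_add[OF vector_field_tangent[OF assms(1)]]
      vector_field_smooth_near assms)

lemma lie_bracket_scale_right:
  assumes h: "smooth_fun_on A UNIV h" and "X \<in> vector_fields A" "Y \<in> vector_fields A"
  shows "lie_bracket A X (vf_scale h Y) =
    vf_add (vf_scale (\<lambda>p. X p h) Y) (vf_scale h (lie_bracket A X Y))"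
proof (intro ext)
  fix p f
  show "lie_bracket A X (vf_scale h Y) p f =
    vf_add (vf_scale (\<lambda>p. X p h) Y) (vf_scale h (lie_bracket A X Y)) p f"
  proof (cases "smooth_near A p f")
    case True
    then show ?thesis
      using h assms(2,3) by (simp add: lie_bracket_def vf_add_def vf_scale_def smooth_fun_on_UNIV
          tangent_mult[OF vector_field_tangent[OF assms(2)]] vector_field_smooth_near algebra_simps)
  next
    case False
    then show ?thesis
      by (simp add: lie_bracket_def vf_add_def vf_scale_def
          tangent_not_smooth[OF vector_field_tangent[OF assms(3)]])
  qed
qed

end


section \<open>Smooth maps\<close>

lemma smooth_map_continuous: "smooth_map A A' F \<Longrightarrow> continuous_on UNIV F"
  by (simp add: smooth_map_def)

lemma smooth_map_vimage_open: "smooth_map A A' F \<Longrightarrow> open W \<Longrightarrow> open (F -` W)"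
  by (simp add: smooth_map_def continuous_on_open_vimage)

lemma smooth_map_charts:
  "smooth_map A A' F \<Longrightarrow> (U, \<phi>) \<in> A \<Longrightarrow> (V, \<psi>) \<in> A' \<Longrightarrow>
    smooth_on (\<phi> ` (U \<inter> F -` V)) (\<psi> \<circ> F \<circ> inv_into U \<phi>)"
  unfolding smooth_map_def by blast

lemma smooth_mapI:
  assumes "continuous_on UNIV F"
    and "\<And>U \<phi> V \<psi>. (U, \<phi>) \<in> A \<Longrightarrow> (V, \<psi>) \<in> A' \<Longrightarrow>
      smooth_on (\<phi> ` (U \<inter> F -` V)) (\<psi> \<circ> F \<circ> inv_into U \<phi>)"
  shows "smooth_map A A' F"
  using assms by (auto simp: smooth_map_def)

lemma smooth_map_pullback:
  fixes A :: "('m::{t2_space,second_countable_topology}, 'e::{real_inner,banach}) atlas"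
    and A' :: "('n::{t2_space,second_countable_topology}, 'f::{real_inner,banach}) atlas"
  assumes "manifold A" "manifold A'" and F: "smooth_map A A' F" and f: "smooth_near A' (F p) f"
  shows "smooth_near A p (\<lambda>q. f (F q))"
proof -
  interpret A: manifold A by fact
  interpret A': manifold A' by fact
  obtain U \<phi> where U: "(U, \<phi>) \<in> A" "p \<in> U" by (rule A.chart_at)
  obtain V \<psi> where V: "(V, \<psi>) \<in> A'" "F p \<in> V" by (rule A'.chart_at)
  obtain B :: "'f set" where B: "resolves_identity B" by (rule A'.resolution)
  obtain T where T: "open T" "\<psi> (F p) \<in> T" "T \<subseteq> \<psi> ` V" "smooth_on T (f \<circ> inv_into V \<psi>)"
    using f by (auto simp: A'.smooth_near_iff_chart[OF V])
  let ?W = "F -` (V \<inter> \<psi> -` T)"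
  let ?S = "\<phi> ` (U \<inter> ?W)"
  have "open ?W" by (intro smooth_map_vimage_open[OF F] A'.chart_vimage_open V T)
  then have S: "open ?S" using A.chart_image_open[OF U(1)] by blast
  have t: "smooth_on ?S (\<psi> \<circ> F \<circ> inv_into U \<phi>)"
    using smooth_map_charts[OF F U(1) V(1)] by (rule smooth_on_subset) auto
  have "(\<psi> \<circ> F \<circ> inv_into U \<phi>) ` ?S \<subseteq> T"
    using A.chart_inverse[OF U(1)] by auto
  from smooth_on_comp[OF B S T(1) this t T(4)]
  have "smooth_on ?S (\<lambda>x. (f \<circ> inv_into V \<psi>) ((\<psi> \<circ> F \<circ> inv_into U \<phi>) x))" .
  then have "smooth_on ?S ((\<lambda>q. f (F q)) \<circ> inv_into U \<phi>)"
    by (rule smooth_on_cong[OF S, rotated])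
      (use A.chart_inverse[OF U(1)] A'.chart_inverse[OF V(1)] in auto)
  with S U V T show ?thesis
    unfolding A.smooth_near_iff_chart[OF U] by (intro exI[of _ ?S]) auto
qed

lemma smooth_map_comp:
  fixes A :: "('m::{t2_space,second_countable_topology}, 'e::{real_inner,banach}) atlas"
    and A' :: "('n::{t2_space,second_countable_topology}, 'f::{real_inner,banach}) atlas"
    and A'' :: "('o::{t2_space,second_countable_topology}, 'h::{real_inner,banach}) atlas"
  assumes "manifold A" "manifold A'" "manifold A''" and F: "smooth_map A A' F" and G: "smooth_map A' A'' G"
  shows "smooth_map A A'' (\<lambda>p. G (F p))"
proof (rule smooth_mapI)
  show "continuous_on UNIV (\<lambda>p. G (F p))"
    using continuous_on_compose2[OF smooth_map_continuous[OF G] smooth_map_continuous[OF F]] by simp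
  interpret A: manifold A by fact
  interpret A': manifold A' by fact
  interpret A'': manifold A'' by fact
  obtain B :: "'f set" where B: "resolves_identity B" by (rule A'.resolution)
  fix U \<phi> W \<eta> assume U: "(U, \<phi>) \<in> A" and W: "(W, \<eta>) \<in> A''"
  show "smooth_on (\<phi> ` (U \<inter> (\<lambda>p. G (F p)) -` W)) (\<eta> \<circ> (\<lambda>p. G (F p)) \<circ> inv_into U \<phi>)"
  proof (rule smooth_on_local)
    fix x assume "x \<in> \<phi> ` (U \<inter> (\<lambda>p. G (F p)) -` W)"
    then obtain p where p: "x = \<phi> p" "p \<in> U" "G (F p) \<in> W" by auto
    obtain V \<psi> where V: "(V, \<psi>) \<in> A'" "F p \<in> V" by (rule A'.chart_at)
    let ?T = "\<psi> ` (V \<inter> G -` W)" and ?S = "\<phi> ` (U \<inter> F -` (V \<inter> G -` W))"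
    have GW: "open (G -` W)" by (rule smooth_map_vimage_open[OF G A''.chart_open[OF W]])
    have T: "open ?T" by (rule A'.chart_image_open[OF V(1) GW])
    have S: "open ?S" using A'.chart_open[OF V(1)] GW
      by (intro A.chart_image_open[OF U(1)] smooth_map_vimage_open[OF F] open_Int)
    have t: "smooth_on ?S (\<psi> \<circ> F \<circ> inv_into U \<phi>)"
      using smooth_map_charts[OF F U V(1)] by (rule smooth_on_subset) auto
    have "(\<psi> \<circ> F \<circ> inv_into U \<phi>) ` ?S \<subseteq> ?T"
      using A.chart_inverse[OF U] by auto
    from smooth_on_comp[OF B S T this t smooth_map_charts[OF G V(1) W]]
    have "smooth_on ?S (\<lambda>x. (\<eta> \<circ> G \<circ> inv_into V \<psi>) ((\<psi> \<circ> F \<circ> inv_into U \<phi>) x))" .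
    then have "smooth_on ?S (\<eta> \<circ> (\<lambda>p. G (F p)) \<circ> inv_into U \<phi>)"
      by (rule smooth_on_cong[OF S, rotated])
        (use A.chart_inverse[OF U] A'.chart_inverse[OF V(1)] in auto)
    with S p V show "\<exists>T. open T \<and> x \<in> T \<and> smooth_on T (\<eta> \<circ> (\<lambda>p. G (F p)) \<circ> inv_into U \<phi>)"
      by (intro exI[of _ ?S]) auto
  qed
qed


lemma map_prod_chart_inverse:
  assumes "manifold A" "manifold A'" "(U, \<phi>) \<in> A" "(V, \<psi>) \<in> A'" "p \<in> U" "q \<in> V"
  shows "inv_into (U \<times> V) (map_prod \<phi> \<psi>) (\<phi> p, \<psi> q) = (p, q)"
proof -
  interpret A: manifold A by fact
  interpret A': manifold A' by fact
  have "inj_on (map_prod \<phi> \<psi>) (U \<times> V)"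
    using A.chart_inverse[OF assms(3)] A'.chart_inverse[OF assms(4)]
    by (intro map_prod_inj_on) (metis inj_on_inverseI)+
  from inv_into_f_f[OF this, of "(p, q)"] show ?thesis using assms(5,6) by simp
qed

lemma manifold_product:
  fixes A :: "('m::{t2_space,second_countable_topology}, 'e::{real_inner,banach}) atlas"
    and A' :: "('n::{t2_space,second_countable_topology}, 'f::{real_inner,banach}) atlas"
  assumes "manifold A" "manifold A'"
  shows "manifold (product_atlas A A')"
proof
  interpret A: manifold A by fact
  interpret A': manifold A' by fact
  note inv = map_prod_chart_inverse[OF assms]
  obtain B :: "'e set" and C :: "'f set" where B: "resolves_identity B" and C: "resolves_identity C"
    using A.resolution A'.resolution by metis
  have "\<exists>B :: ('e \<times> 'f) set. finite B \<and> span B = UNIV"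
  proof -
    obtain D :: "('e \<times> 'f) set" where D: "resolves_identity D"
      using resolves_identity_Times[OF B C] by blast
    have "x \<in> span D" for x
    proof -
      have "(\<Sum>b\<in>D. (x \<bullet> b) *\<^sub>R b) \<in> span D" by (intro span_sum span_scale span_base)
      then show ?thesis using D unfolding resolves_identity_def by metis
    qed
    with D show ?thesis by (intro exI[of _ D]) (auto simp: resolves_identity_def)
  qed
  moreover have chart: "chart (U \<times> V) (map_prod \<phi> \<psi>)" if U: "(U, \<phi>) \<in> A" and V: "(V, \<psi>) \<in> A'" for U \<phi> V \<psi>
  proof -
    have U': "open U" "open (\<phi> ` U)" "continuous_on U \<phi>" "continuous_on (\<phi> ` U) (inv_into U \<phi>)"
      using A.is_chart[OF U] by (auto simp: chart_def homeomorphism_def)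
    have V': "open V" "open (\<psi> ` V)" "continuous_on V \<psi>" "continuous_on (\<psi> ` V) (inv_into V \<psi>)"
      using A'.is_chart[OF V] by (auto simp: chart_def homeomorphism_def)
    have im: "map_prod \<phi> \<psi> ` (U \<times> V) = \<phi> ` U \<times> \<psi> ` V" by auto
    have "continuous_on (U \<times> V) (map_prod \<phi> \<psi>)"
      unfolding map_prod_def case_prod_beta
      by (intro continuous_on_Pair continuous_on_compose2[OF U'(3)] continuous_on_compose2[OF V'(3)]
          continuous_on_fst continuous_on_snd continuous_on_id) auto
    moreover have "continuous_on (\<phi> ` U \<times> \<psi> ` V) (\<lambda>z. (inv_into U \<phi> (fst z), inv_into V \<psi> (snd z)))"
      by (intro continuous_on_Pair continuous_on_compose2[OF U'(4)] continuous_on_compose2[OF V'(4)]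
          continuous_on_fst continuous_on_snd continuous_on_id) auto
    then have "continuous_on (\<phi> ` U \<times> \<psi> ` V) (inv_into (U \<times> V) (map_prod \<phi> \<psi>))"
      by (rule continuous_on_eq) (use inv[OF U V] A.chart_inverse[OF U] A'.chart_inverse[OF V] in auto)
    ultimately have "homeomorphism (U \<times> V) (\<phi> ` U \<times> \<psi> ` V) (map_prod \<phi> \<psi>) (inv_into (U \<times> V) (map_prod \<phi> \<psi>))"
      by (intro homeomorphismI) (use inv[OF U V] in auto)
    then show ?thesis
      using U' V' by (simp add: chart_def im open_Times)
  qed
  moreover have "(\<Union>(U, \<phi>)\<in>product_atlas A A'. U) = UNIV"
  proof -
    have "z \<in> (\<Union>(U, \<phi>)\<in>product_atlas A A'. U)" for z
    proof -
      obtain U \<phi> where U: "(U, \<phi>) \<in> A" "fst z \<in> U" by (rule A.chart_at)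
      obtain V \<psi> where V: "(V, \<psi>) \<in> A'" "snd z \<in> V" by (rule A'.chart_at)
      from U V have "(U \<times> V, map_prod \<phi> \<psi>) \<in> product_atlas A A'" "z \<in> U \<times> V"
        by (auto simp: product_atlas_def mem_Times_iff)
      then show ?thesis by (intro UN_I[of "(U \<times> V, map_prod \<phi> \<psi>)"]) simp_all
    qed
    then show ?thesis by (intro equalityI subsetI UNIV_I)
  qed
  moreover have transition: "smooth_on (map_prod \<phi> \<psi> ` (U \<times> V \<inter> U' \<times> V'))
      (map_prod \<phi>' \<psi>' \<circ> inv_into (U \<times> V) (map_prod \<phi> \<psi>))"
    if U: "(U, \<phi>) \<in> A" "(U', \<phi>') \<in> A" and V: "(V, \<psi>) \<in> A'" "(V', \<psi>') \<in> A'" for U \<phi> V \<psi> U' \<phi>' V' \<psi>'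
  proof -
    let ?S = "\<phi> ` (U \<inter> U')" and ?T = "\<psi> ` (V \<inter> V')"
    have im: "map_prod \<phi> \<psi> ` (U \<times> V \<inter> U' \<times> V') = ?S \<times> ?T"
      by (auto simp: map_prod_def image_iff) 
    have o: "open ?S" "open ?T"
      using A.chart_image_open[OF U(1) A.chart_open[OF U(2)]]
        A'.chart_image_open[OF V(1) A'.chart_open[OF V(2)]] by auto
    then have ST: "open (?S \<times> ?T)" by (rule open_Times)
    have "smooth_on (?S \<times> ?T) (\<lambda>z. (\<phi>' \<circ> inv_into U \<phi>) (fst z))"
      by (rule smooth_on_comp[OF B ST o(1) _ smooth_on_bounded_linear[OF bounded_linear_fst ST]
            A.transition_smooth[OF U]]) auto
    moreover have "smooth_on (?S \<times> ?T) (\<lambda>z. (\<psi>' \<circ> inv_into V \<psi>) (snd z))"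
      by (rule smooth_on_comp[OF C ST o(2) _ smooth_on_bounded_linear[OF bounded_linear_snd ST]
            A'.transition_smooth[OF V]]) auto
    ultimately have "smooth_on (?S \<times> ?T) (\<lambda>z. ((\<phi>' \<circ> inv_into U \<phi>) (fst z), (\<psi>' \<circ> inv_into V \<psi>) (snd z)))"
      by (rule smooth_on_Pair[OF ST])
    then show ?thesis
      unfolding im
      by (rule smooth_on_cong[OF ST, rotated])
        (use inv[OF U(1) V(1)] A.chart_inverse[OF U(1)] A'.chart_inverse[OF V(1)] in auto)
  qed
  ultimately show "smooth_manifold (product_atlas A A')"
    unfolding smooth_manifold_def
  proof (intro conjI ballI)
    fix c assume "c \<in> product_atlas A A'"
    then obtain U \<phi> V \<psi> where c: "c = (U \<times> V, map_prod \<phi> \<psi>)" "(U, \<phi>) \<in> A" "(V, \<psi>) \<in> A'"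
      by (auto simp: product_atlas_def)
    then show "case c of (W, \<eta>) \<Rightarrow> chart W \<eta>" using chart by simp
    have "smooth_on (map_prod \<phi> \<psi> ` (U \<times> V \<inter> W')) (\<eta>' \<circ> inv_into (U \<times> V) (map_prod \<phi> \<psi>))"
      if "(W', \<eta>') \<in> product_atlas A A'" for W' \<eta>'
    proof -
      from that obtain U' \<phi>' V' \<psi>' where "W' = U' \<times> V'" "\<eta>' = map_prod \<phi>' \<psi>'"
        "(U', \<phi>') \<in> A" "(V', \<psi>') \<in> A'"
        by (auto simp: product_atlas_def)
      with c(2,3) transition show ?thesis by simp
    qed
    with c(1) show "case c of (W, \<eta>) \<Rightarrow> \<forall>(W', \<eta>')\<in>product_atlas A A'.
        smooth_on (\<eta> ` (W \<inter> W')) (\<eta>' \<circ> inv_into W \<eta>)"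
      by auto
  qed
qed

lemma smooth_map_ident: "manifold A \<Longrightarrow> smooth_map A A (\<lambda>p. p)"
  using manifold.transition_smooth by (intro smooth_mapI) (auto simp: comp_def)

lemma smooth_map_const:
  assumes "manifold A"
  shows "smooth_map A A' (\<lambda>p. c)"
proof (rule smooth_mapI)
  fix U \<phi> V \<psi>
  show "smooth_on (\<phi> ` (U \<inter> (\<lambda>p. c) -` V)) (\<psi> \<circ> (\<lambda>p. c) \<circ> inv_into U \<phi>)"
    by (simp add: comp_def smooth_on_const)
qed simp

lemma smooth_map_Pair:
  fixes A :: "('m::{t2_space,second_countable_topology}, 'e::{real_inner,banach}) atlas"
    and A' :: "('n::{t2_space,second_countable_topology}, 'f::{real_inner,banach}) atlas"
    and A'' :: "('o::{t2_space,second_countable_topology}, 'h::{real_inner,banach}) atlas"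
  assumes "manifold A" "manifold A'" "manifold A''"
    and F: "smooth_map A A' F" and G: "smooth_map A A'' G"
  shows "smooth_map A (product_atlas A' A'') (\<lambda>p. (F p, G p))"
proof (rule smooth_mapI)
  show "continuous_on UNIV (\<lambda>p. (F p, G p))"
    by (intro continuous_on_Pair smooth_map_continuous[OF F] smooth_map_continuous[OF G])
  interpret A: manifold A by fact
  interpret A': manifold A' by fact
  interpret A'': manifold A'' by fact
  fix U \<phi> W \<eta> assume U: "(U, \<phi>) \<in> A" and W: "(W, \<eta>) \<in> product_atlas A' A''"
  then obtain V \<psi> V' \<psi>' where V: "(V, \<psi>) \<in> A'" "(V', \<psi>') \<in> A''"
    and W_eq: "W = V \<times> V'" "\<eta> = map_prod \<psi> \<psi>'"
    by (auto simp: product_atlas_def)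
  let ?S = "\<phi> ` (U \<inter> (\<lambda>p. (F p, G p)) -` W)"
  have eq: "(\<lambda>p. (F p, G p)) -` W = F -` V \<inter> G -` V'" by (auto simp: W_eq)
  have S: "open ?S" unfolding eq
    by (intro A.chart_image_open[OF U] open_Int smooth_map_vimage_open[OF F]
        smooth_map_vimage_open[OF G] A'.chart_open[OF V(1)] A''.chart_open[OF V(2)])
  have "smooth_on ?S (\<psi> \<circ> F \<circ> inv_into U \<phi>)" "smooth_on ?S (\<psi>' \<circ> G \<circ> inv_into U \<phi>)"
    by (rule smooth_on_subset[OF smooth_map_charts[OF F U V(1)]]
        smooth_on_subset[OF smooth_map_charts[OF G U V(2)]]; auto simp: W_eq)+
  from smooth_on_Pair[OF S this]
  show "smooth_on ?S (\<eta> \<circ> (\<lambda>p. (F p, G p)) \<circ> inv_into U \<phi>)"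
    by (simp add: W_eq comp_def)
qed

lemma smooth_map_fst:
  fixes A :: "('m::{t2_space,second_countable_topology}, 'e::{real_inner,banach}) atlas"
    and A' :: "('n::{t2_space,second_countable_topology}, 'f::{real_inner,banach}) atlas"
  assumes "manifold A" "manifold A'"
  shows "smooth_map (product_atlas A A') A fst"
proof (rule smooth_mapI)
  interpret A: manifold A by fact
  interpret A': manifold A' by fact
  obtain B :: "'e set" where B: "resolves_identity B" by (rule A.resolution)
  fix W \<eta> U' \<phi>' assume W: "(W, \<eta>) \<in> product_atlas A A'" and U': "(U', \<phi>') \<in> A"
  then obtain U \<phi> V \<psi> where U: "(U, \<phi>) \<in> A" and V: "(V, \<psi>) \<in> A'"
    and W_eq: "W = U \<times> V" "\<eta> = map_prod \<phi> \<psi>"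
    by (auto simp: product_atlas_def)
  let ?S = "\<phi> ` (U \<inter> U')" and ?T = "\<psi> ` V"
  have im: "\<eta> ` (W \<inter> fst -` U') = ?S \<times> ?T"
    by (auto simp: W_eq map_prod_def image_iff)
  have o: "open ?S" "open ?T"
    using A.chart_image_open[OF U A.chart_open[OF U']] A'.chart_image_open[OF V open_UNIV] by auto
  then have ST: "open (?S \<times> ?T)" by (rule open_Times)
  have "smooth_on (?S \<times> ?T) (\<lambda>z. (\<phi>' \<circ> inv_into U \<phi>) (fst z))"
    by (rule smooth_on_comp[OF B ST o(1) _ smooth_on_bounded_linear[OF bounded_linear_fst ST]
          A.transition_smooth[OF U U']]) auto
  then show "smooth_on (\<eta> ` (W \<inter> fst -` U')) (\<phi>' \<circ> fst \<circ> inv_into W \<eta>)"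
    unfolding im
    by (rule smooth_on_cong[OF ST, rotated])
      (use map_prod_chart_inverse[OF assms U V] A.chart_inverse[OF U] in \<open>auto simp: W_eq\<close>)
qed (intro continuous_intros)

lemma smooth_map_snd:
  fixes A :: "('m::{t2_space,second_countable_topology}, 'e::{real_inner,banach}) atlas"
    and A' :: "('n::{t2_space,second_countable_topology}, 'f::{real_inner,banach}) atlas"
  assumes "manifold A" "manifold A'"
  shows "smooth_map (product_atlas A A') A' snd"
proof (rule smooth_mapI)
  interpret A: manifold A by fact
  interpret A': manifold A' by fact
  obtain B :: "'f set" where B: "resolves_identity B" by (rule A'.resolution)
  fix W \<eta> V' \<psi>' assume W: "(W, \<eta>) \<in> product_atlas A A'" and V': "(V', \<psi>') \<in> A'"
  then obtain U \<phi> V \<psi> where U: "(U, \<phi>) \<in> A" and V: "(V, \<psi>) \<in> A'"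
    and W_eq: "W = U \<times> V" "\<eta> = map_prod \<phi> \<psi>"
    by (auto simp: product_atlas_def)
  let ?S = "\<phi> ` U" and ?T = "\<psi> ` (V \<inter> V')"
  have im: "\<eta> ` (W \<inter> snd -` V') = ?S \<times> ?T"
    by (auto simp: W_eq map_prod_def image_iff)
  have o: "open ?S" "open ?T"
    using A'.chart_image_open[OF V A'.chart_open[OF V']] A.chart_image_open[OF U open_UNIV] by auto
  then have ST: "open (?S \<times> ?T)" by (rule open_Times)
  have "smooth_on (?S \<times> ?T) (\<lambda>z. (\<psi>' \<circ> inv_into V \<psi>) (snd z))"
    by (rule smooth_on_comp[OF B ST o(2) _ smooth_on_bounded_linear[OF bounded_linear_snd ST]
          A'.transition_smooth[OF V V']]) auto
  then show "smooth_on (\<eta> ` (W \<inter> snd -` V')) (\<psi>' \<circ> snd \<circ> inv_into W \<eta>)"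
    unfolding im
    by (rule smooth_on_cong[OF ST, rotated])
      (use map_prod_chart_inverse[OF assms U V] A'.chart_inverse[OF V] in \<open>auto simp: W_eq\<close>)
qed (intro continuous_intros)


section \<open>Differentiation with respect to one variable\<close>

lemma smooth_near_product_chart:
  fixes A :: "('m::{t2_space,second_countable_topology}, 'e::{real_inner,banach}) atlas"
    and A' :: "('n::{t2_space,second_countable_topology}, 'f::{real_inner,banach}) atlas"
  assumes "manifold A" "manifold A'"
    and U: "(U, \<phi>) \<in> A" "p \<in> U" and V: "(V, \<psi>) \<in> A'" "q \<in> V"
    and K: "smooth_near (product_atlas A A') (p, q) K"
  obtains T where "open T" "(\<phi> p, \<psi> q) \<in> T"
    and "smooth_on T (\<lambda>(x, y). K (inv_into U \<phi> x, inv_into V \<psi> y))"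
    and "\<And>r s. r \<in> U \<Longrightarrow> s \<in> V \<Longrightarrow> (\<phi> r, \<psi> s) \<in> T \<Longrightarrow> smooth_near (product_atlas A A') (r, s) K"
proof -
  interpret A: manifold A by fact
  interpret A': manifold A' by fact
  interpret P: manifold "product_atlas A A'" by (rule manifold_product) fact+
  have W: "(U \<times> V, map_prod \<phi> \<psi>) \<in> product_atlas A A'"
    using U V by (auto simp: product_atlas_def)
  have "(p, q) \<in> U \<times> V" using U V by simp
  from K obtain T where T: "open T" "(\<phi> p, \<psi> q) \<in> T" "T \<subseteq> map_prod \<phi> \<psi> ` (U \<times> V)"
    "smooth_on T (K \<circ> inv_into (U \<times> V) (map_prod \<phi> \<psi>))"
    unfolding P.smooth_near_iff_chart[OF W \<open>(p, q) \<in> U \<times> V\<close>] by auto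
  show thesis
  proof
    show "smooth_on T (\<lambda>(x, y). K (inv_into U \<phi> x, inv_into V \<psi> y))"
      by (rule smooth_on_cong[OF T(1) _ T(4)])
        (use T(3) map_prod_chart_inverse[OF assms(1,2) U(1) V(1)] A.chart_inverse[OF U(1)]
          A'.chart_inverse[OF V(1)] in force)
    fix r s assume "r \<in> U" "s \<in> V" "(\<phi> r, \<psi> s) \<in> T"
    then show "smooth_near (product_atlas A A') (r, s) K"
      using T P.smooth_near_iff_chart[OF W, of "(r, s)" K] by auto
  qed (use T in auto)
qed

lemma smooth_near_section:
  fixes A :: "('m::{t2_space,second_countable_topology}, 'e::{real_inner,banach}) atlas"
    and A' :: "('n::{t2_space,second_countable_topology}, 'f::{real_inner,banach}) atlas"
  assumes "manifold A" "manifold A'" and K: "smooth_near (product_atlas A A') (p, q) K"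
  shows "smooth_near A' q (\<lambda>r. K (p, r))" "smooth_near A p (\<lambda>r. K (r, q))"
  using assms
  by (auto intro!: smooth_map_pullback[of _ "product_atlas A A'" "\<lambda>r. (p, r)" q K]
      smooth_map_pullback[of _ "product_atlas A A'" "\<lambda>r. (r, q)" p K]
      smooth_map_Pair smooth_map_const smooth_map_ident manifold_product)

text \<open>
  A vector field along a map, applied in one variable of a function of two variables.  For
  constant \<open>\<sigma>\<close> this yields the smoothness of invariant fields, for the identity that of
  coefficients with respect to an invariant frame.  In coordinates the value is the sum over \<open>c\<close>
  of \<open>Z p\<close> applied to the \<open>c\<close>-th coordinate, times a partial derivative of \<open>K\<close> in the second
  variable; both factors are smooth in \<open>p\<close>.
\<close>

lemma smooth_near_vector_field_along:
  fixes A :: "('m::{t2_space,second_countable_topology}, 'e::{real_inner,banach}) atlas"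
    and A' :: "('n::{t2_space,second_countable_topology}, 'f::{real_inner,banach}) atlas"
  assumes "manifold A" "manifold A'" and \<sigma>: "smooth_map A A' \<sigma>"
    and Z: "\<And>p. Z p \<in> tangent_space A' (\<sigma> p)"
    and Z_smooth: "\<And>f. smooth_near A' (\<sigma> p0) f \<Longrightarrow> smooth_near A p0 (\<lambda>p. Z p f)"
    and K: "smooth_near (product_atlas A A') (p0, \<sigma> p0) K"
  shows "smooth_near A p0 (\<lambda>p. Z p (\<lambda>q. K (p, q)))"
proof -
  interpret A: manifold A by fact
  interpret A': manifold A' by fact
  interpret P: manifold "product_atlas A A'" by (rule manifold_product) fact+
  obtain U \<phi> where U: "(U, \<phi>) \<in> A" "p0 \<in> U" by (rule A.chart_at)
  obtain V \<psi> where V: "(V, \<psi>) \<in> A'" "\<sigma> p0 \<in> V" by (rule A'.chart_at)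
  obtain B :: "('e \<times> 'f) set" where B: "resolves_identity B" by (rule P.resolution)
  obtain C :: "'f set" where C: "resolves_identity C" by (rule A'.resolution)
  let ?k = "\<lambda>(x, y). K (inv_into U \<phi> x, inv_into V \<psi> y)"
  obtain T where T: "open T" "(\<phi> p0, \<psi> (\<sigma> p0)) \<in> T" "smooth_on T ?k"
    "\<And>r s. r \<in> U \<Longrightarrow> s \<in> V \<Longrightarrow> (\<phi> r, \<psi> s) \<in> T \<Longrightarrow> smooth_near (product_atlas A A') (r, s) K"
    using smooth_near_product_chart[OF assms(1,2) U V K] by blast
  let ?s = "\<psi> \<circ> \<sigma> \<circ> inv_into U \<phi>" and ?S = "\<phi> ` (U \<inter> \<sigma> -` V)"
  \<comment> \<open>Where the graph of the map, in coordinates, lies in the domain on which K is known to be smooth.\<close>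
  define S where "S = ?S \<inter> (\<lambda>x. (x, ?s x)) -` T"
  have S0: "open ?S"
    by (intro A.chart_image_open[OF U(1)] smooth_map_vimage_open[OF \<sigma>] A'.chart_open[OF V(1)])
  have gr: "smooth_on ?S (\<lambda>x. (x, ?s x))"
    by (intro smooth_on_Pair smooth_on_ident S0 smooth_map_charts[OF \<sigma> U(1) V(1)])
  then have "continuous_on ?S (\<lambda>x. (x, ?s x))"
    unfolding smooth_on_def using Ck_on.simps(1) by blast
  then have S: "open S"
    unfolding S_def by (rule continuous_open_preimage[OF _ S0 T(1)])
  have eq: "inv_into U \<phi> (\<phi> p) = p" if "p \<in> U" for p by (rule A.chart_inverse[OF U(1) that])
  have p0: "\<phi> p0 \<in> S" using U V T by (auto simp: S_def eq)
  let ?d = "\<lambda>c x. frechet_derivative ?k (at (x, ?s x)) (0, c)"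
  have d: "smooth_on S (?d c)" for c
    by (rule smooth_on_comp[OF B S T(1) _ smooth_on_subset[OF gr] smooth_on_derivative[OF T(3)]])
      (auto simp: S_def)
  have "smooth_near A p0 (\<lambda>p. \<Sum>c\<in>C. Z p (\<lambda>q. \<psi> q \<bullet> c) * ?d c (\<phi> p))"
    by (intro A.smooth_near_sum A.smooth_near_mult Z_smooth A'.smooth_near_coordinate[OF V]
        A.smooth_near_chart_comp[OF U S p0 d])
  moreover have "\<forall>\<^sub>F p in nhds p0. (\<Sum>c\<in>C. Z p (\<lambda>q. \<psi> q \<bullet> c) * ?d c (\<phi> p)) = Z p (\<lambda>q. K (p, q))"
    unfolding eventually_nhds
  proof (intro exI conjI ballI)
    show "open (U \<inter> \<phi> -` S)" by (rule A.chart_vimage_open[OF U(1) S])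
    fix p assume p: "p \<in> U \<inter> \<phi> -` S"
    then obtain x where x: "p \<in> U" "\<phi> p = \<phi> x" "x \<in> U" "\<sigma> x \<in> V" and xT: "(\<phi> x, ?s (\<phi> x)) \<in> T"
      by (auto simp: S_def)
    then have "x = p" using eq by metis
    with x xT have pU: "p \<in> U" and pV: "\<sigma> p \<in> V" and pT: "(\<phi> p, \<psi> (\<sigma> p)) \<in> T"
      by (auto simp: eq)
    have "smooth_near A' (\<sigma> p) (\<lambda>q. K (p, q))"
      using T(4)[OF pU pV pT] by (rule smooth_near_section[OF assms(1,2)])
    then have "Z p (\<lambda>q. K (p, q)) = (\<Sum>c\<in>C. Z p (\<lambda>q. \<psi> q \<bullet> c) *
        frechet_derivative ((\<lambda>q. K (p, q)) \<circ> inv_into V \<psi>) (at (\<psi> (\<sigma> p))) c)"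
      by (rule A'.tangent_eq_directional_derivative(2)[OF Z C V(1) pV])
    moreover have "(\<lambda>q. K (p, q)) \<circ> inv_into V \<psi> = (\<lambda>y. ?k (\<phi> p, y))"
      using eq[OF pU] by auto
    ultimately show "(\<Sum>c\<in>C. Z p (\<lambda>q. \<psi> q \<bullet> c) * ?d c (\<phi> p)) = Z p (\<lambda>q. K (p, q))"
      using frechet_derivative_second_argument[OF T(3) pT] eq[OF pU] by simp
  qed (use U p0 in auto)
  ultimately show ?thesis by (rule A.smooth_near_cong)
qed

text \<open>
  In charts, \<open>v\<close> and \<open>w\<close> are directional derivatives with respect to different variables.
\<close>

lemma tangent_vectors_commute:
  fixes A :: "('m::{t2_space,second_countable_topology}, 'e::{real_inner,banach}) atlas"
    and A' :: "('n::{t2_space,second_countable_topology}, 'f::{real_inner,banach}) atlas"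
  assumes "manifold A" "manifold A'"
    and v: "v \<in> tangent_space A p" and w: "w \<in> tangent_space A' q"
    and K: "smooth_near (product_atlas A A') (p, q) K"
  shows "v (\<lambda>s. w (\<lambda>r. K (s, r))) = w (\<lambda>r. v (\<lambda>s. K (s, r)))"
proof -
  interpret A: manifold A by fact
  interpret A': manifold A' by fact
  obtain U \<phi> where U: "(U, \<phi>) \<in> A" "p \<in> U" by (rule A.chart_at)
  obtain V \<psi> where V: "(V, \<psi>) \<in> A'" "q \<in> V" by (rule A'.chart_at)
  obtain B :: "'e set" where B: "resolves_identity B" by (rule A.resolution)
  obtain C :: "'f set" where C: "resolves_identity C" by (rule A'.resolution)
  let ?k = "\<lambda>(x, y). K (inv_into U \<phi> x, inv_into V \<psi> y)"
  obtain T where T: "open T" "(\<phi> p, \<psi> q) \<in> T" "smooth_on T ?k"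
    "\<And>r s. r \<in> U \<Longrightarrow> s \<in> V \<Longrightarrow> (\<phi> r, \<psi> s) \<in> T \<Longrightarrow> smooth_near (product_atlas A A') (r, s) K"
    using smooth_near_product_chart[OF assms(1,2) U V K] by blast
  define v' where "v' = (\<Sum>b\<in>B. v (\<lambda>s. \<phi> s \<bullet> b) *\<^sub>R b)"
  define w' where "w' = (\<Sum>c\<in>C. w (\<lambda>r. \<psi> r \<bullet> c) *\<^sub>R c)"
  define g where "g x = frechet_derivative (\<lambda>y. ?k (x, y)) (at (\<psi> q)) w'" for x
  define h where "h y = frechet_derivative (\<lambda>x. ?k (x, y)) (at (\<phi> p)) v'" for y
  obtain D :: "('e \<times> 'f) set" where D: "resolves_identity D"
    using resolves_identity_Times[OF B C] by blast
  let ?Tg = "(\<lambda>x. (x, \<psi> q)) -` T" and ?Th = "(\<lambda>y. (\<phi> p, y)) -` T"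
  have Tg: "open ?Tg" and Th: "open ?Th"
    using T(1) by (auto intro!: open_vimage continuous_intros)
  have "smooth_on ?Tg (\<lambda>x. frechet_derivative ?k (at (x, \<psi> q)) (0, w'))"
    by (rule smooth_on_comp[OF D Tg T(1) _ _ smooth_on_derivative[OF T(3)]])
      (auto intro!: smooth_on_Pair smooth_on_ident smooth_on_const Tg)
  then have g: "smooth_on ?Tg g"
    by (rule smooth_on_cong[OF Tg, rotated])
      (use frechet_derivative_second_argument[OF T(3)] in \<open>simp add: g_def\<close>)
  have "smooth_on ?Th (\<lambda>y. frechet_derivative ?k (at (\<phi> p, y)) (v', 0))"
    by (rule smooth_on_comp[OF D Th T(1) _ _ smooth_on_derivative[OF T(3)]])
      (auto intro!: smooth_on_Pair smooth_on_ident smooth_on_const Th)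
  then have h: "smooth_on ?Th h"
    by (rule smooth_on_cong[OF Th, rotated])
      (use frechet_derivative_first_argument[OF T(3)] in \<open>simp add: h_def\<close>)
  have "\<forall>\<^sub>F s in nhds p. w (\<lambda>r. K (s, r)) = g (\<phi> s)"
    unfolding eventually_nhds
  proof (intro exI conjI ballI)
    show "open (U \<inter> \<phi> -` ?Tg)" by (rule A.chart_vimage_open[OF U(1) Tg])
    fix s assume s: "s \<in> U \<inter> \<phi> -` ?Tg"
    then have "smooth_near A' q (\<lambda>r. K (s, r))"
      using V(2) by (intro smooth_near_section[OF assms(1,2)] T(4)) auto
    from A'.tangent_eq_directional_derivative(1)[OF w C V this]
    show "w (\<lambda>r. K (s, r)) = g (\<phi> s)"
      using s A.chart_inverse[OF U(1)] by (simp add: g_def w'_def comp_def)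
  qed (use U T in auto)
  then have "v (\<lambda>s. w (\<lambda>r. K (s, r))) = v (\<lambda>s. g (\<phi> s))"
    by (rule A.tangent_local[OF v])
  also have "\<dots> = frechet_derivative g (at (\<phi> p)) v'"
    unfolding v'_def using T(2) by (intro A.tangent_chart_comp[OF v B U Tg _ g]) simp
  also have "\<dots> = frechet_derivative h (at (\<psi> q)) w'"
    unfolding g_def h_def by (rule mixed_partials_commute[OF T(1,3,2)])
  also have "\<dots> = w (\<lambda>r. h (\<psi> r))"
    unfolding w'_def using T(2) by (intro A'.tangent_chart_comp[OF w C V Th _ h, symmetric]) simp
  also have "\<dots> = w (\<lambda>r. v (\<lambda>s. K (s, r)))"
  proof (rule A'.tangent_local[OF w], unfold eventually_nhds, intro exI conjI ballI)
    show "open (V \<inter> \<psi> -` ?Th)" by (rule A'.chart_vimage_open[OF V(1) Th])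
    fix r assume r: "r \<in> V \<inter> \<psi> -` ?Th"
    then have "smooth_near A p (\<lambda>s. K (s, r))"
      using U(2) by (intro smooth_near_section[OF assms(1,2)] T(4)) auto
    from A.tangent_eq_directional_derivative(1)[OF v B U this]
    show "h (\<psi> r) = v (\<lambda>s. K (s, r))"
      using r A'.chart_inverse[OF V(1)] by (simp add: h_def v'_def comp_def)
  qed (use V T in auto)
  finally show ?thesis .
qed


section \<open>Diffeomorphisms acting on vector fields\<close>

lemma (in manifold) smooth_near_diffeomorphism:
  assumes F: "diffeomorphism A F"
  shows "smooth_near A p (\<lambda>q. f (F q)) \<longleftrightarrow> smooth_near A (F p) f"
proof
  have M: "manifold A" by unfold_locales
  have F': "bij F" "smooth_map A A F" "smooth_map A A (inv F)" using F by (auto simp: diffeomorphism_def)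
  note inv = bij_inv_eq_iff[OF F'(1)]
  show "smooth_near A p (\<lambda>q. f (F q))" if "smooth_near A (F p) f"
    using smooth_map_pullback[OF M M F'(2) that] .
  assume *: "smooth_near A p (\<lambda>q. f (F q))"
  have "inv F (F p) = p" using F'(1) by (simp add: bij_is_inj)
  with * have "smooth_near A (inv F (F p)) (\<lambda>q. f (F q))" by simp
  from smooth_map_pullback[OF M M F'(3) this]
  show "smooth_near A (F p) f" using F'(1) by (simp add: bij_is_surj surj_f_inv_f)
qed

context manifold
begin

context
  fixes F assumes F: "diffeomorphism A F"
begin

lemma diffeo_inv: "inv F (F p) = p" "F (inv F p) = p"
  using F by (auto simp: diffeomorphism_def bij_is_inj bij_is_surj surj_f_inv_f)

lemma diffeomorphism_inv: "diffeomorphism A (inv F)"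
  using F by (auto simp: diffeomorphism_def bij_imp_bij_inv inv_inv_eq)

lemma pushforward_apply: "pushforward F X p f = X (inv F p) (\<lambda>q. f (F q))"
  by (simp add: pushforward_def comp_def)

lemma tangent_image:
  assumes v: "v \<in> tangent_space A (inv F p)"
  shows "(\<lambda>f. v (\<lambda>q. f (F q))) \<in> tangent_space A p"
proof -
  have n: "smooth_near A (inv F p) (\<lambda>q. f (F q)) \<longleftrightarrow> smooth_near A p f" for f
    using smooth_near_diffeomorphism[OF F, of "inv F p" f] by (simp add: diffeo_inv)
  show ?thesis
    by (rule tangentI)
      (simp_all add: n tangent_not_smooth[OF v] tangent_add[OF v] tangent_mult[OF v]
        tangent_scale[OF v] diffeo_inv)
qed

lemma pushforward_vector_field:
  assumes X: "X \<in> vector_fields A"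
  shows "pushforward F X \<in> vector_fields A"
proof (rule vector_fieldI)
  show "pushforward F X p \<in> tangent_space A p" for p
    using tangent_image[OF vector_field_tangent[OF X]] by (simp add: pushforward_apply[abs_def])
  fix p f assume "smooth_near A p f"
  then have "smooth_near A (inv F p) (\<lambda>q. f (F q))"
    by (simp add: smooth_near_diffeomorphism[OF F] diffeo_inv)
  from vector_field_smooth_near[OF X this] show "smooth_near A p (\<lambda>q. pushforward F X q f)"
    unfolding pushforward_apply
    by (simp add: smooth_near_diffeomorphism[OF diffeomorphism_inv, of p "\<lambda>r. X r (\<lambda>q. f (F q))"])
qed

lemma pushforward_add: "pushforward F (vf_add X Y) = vf_add (pushforward F X) (pushforward F Y)"
  by (simp add: pushforward_def vf_add_def)

lemma pushforward_scale: "pushforward F (vf_scale h X) = vf_scale (\<lambda>p. h (inv F p)) (pushforward F X)"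
  by (simp add: pushforward_def vf_scale_def)

lemma pushforward_lie_bracket:
  "pushforward F (lie_bracket A X Y) = lie_bracket A (pushforward F X) (pushforward F Y)"
proof (intro ext)
  fix p f
  show "pushforward F (lie_bracket A X Y) p f = lie_bracket A (pushforward F X) (pushforward F Y) p f"
    by (simp add: pushforward_apply lie_bracket_def smooth_near_diffeomorphism[OF F] diffeo_inv)
qed

lemma pushforward_inv: "pushforward (inv F) (pushforward F X) = X"
  and pushforward_inv': "pushforward F (pushforward (inv F) X) = X"
  using F by (auto simp: fun_eq_iff pushforward_def comp_def diffeomorphism_def inv_inv_eq diffeo_inv)

end

end


section \<open>Connections and global frames\<close>

context manifold
begin

definition global_frame :: "'b set \<Rightarrow> ('b \<Rightarrow> 'm vfield) \<Rightarrow> bool" where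
  "global_frame B E \<longleftrightarrow> finite B \<and> (\<forall>b\<in>B. E b \<in> vector_fields A) \<and>
     (\<forall>Y\<in>vector_fields A. \<exists>h. (\<forall>b\<in>B. smooth_fun_on A UNIV (h b)) \<and>
        Y = (\<lambda>p f. \<Sum>b\<in>B. h b p * E b p f))"

lemma frame_combination_induct:
  assumes "finite B" "\<And>b. b \<in> B \<Longrightarrow> E b \<in> vector_fields A"
    and "\<And>b. b \<in> B \<Longrightarrow> smooth_fun_on A UNIV (h b)"
    and zero: "P (\<lambda>p f. 0)"
    and basis: "\<And>b. b \<in> B \<Longrightarrow> P (E b)"
    and add: "\<And>Y Y'. Y \<in> vector_fields A \<Longrightarrow> Y' \<in> vector_fields A \<Longrightarrow> P Y \<Longrightarrow> P Y' \<Longrightarrow> P (vf_add Y Y')"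
    and scale: "\<And>k Y. smooth_fun_on A UNIV k \<Longrightarrow> Y \<in> vector_fields A \<Longrightarrow> P Y \<Longrightarrow> P (vf_scale k Y)"
  shows "(\<lambda>p f. \<Sum>b\<in>B. h b p * E b p f) \<in> vector_fields A \<and> P (\<lambda>p f. \<Sum>b\<in>B. h b p * E b p f)"
  using assms(1-3) basis
proof (induction B rule: finite_induct)
  case empty
  then show ?case using zero zero_vector_field by simp
next
  case (insert b B)
  have *: "(\<lambda>p f. \<Sum>c\<in>insert b B. h c p * E c p f) =
      vf_add (vf_scale (h b) (E b)) (\<lambda>p f. \<Sum>c\<in>B. h c p * E c p f)"
    using insert.hyps by (simp add: vf_add_def vf_scale_def)
  show ?case
    unfolding * using insert
    by (auto intro!: vf_add_vector_field vf_scale_vector_field add scale)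
qed

text \<open>
  Statements that are linear over the smooth functions need to be checked on a frame only.  The
  zero field is a separate case because the frame of a manifold of dimension 0 may be empty.
\<close>

lemma global_frame_induct:
  assumes "global_frame B E" and Y: "Y \<in> vector_fields A"
    and zero: "P (\<lambda>p f. 0)"
    and basis: "\<And>b. b \<in> B \<Longrightarrow> P (E b)"
    and add: "\<And>Y Y'. Y \<in> vector_fields A \<Longrightarrow> Y' \<in> vector_fields A \<Longrightarrow> P Y \<Longrightarrow> P Y' \<Longrightarrow> P (vf_add Y Y')"
    and scale: "\<And>k Y. smooth_fun_on A UNIV k \<Longrightarrow> Y \<in> vector_fields A \<Longrightarrow> P Y \<Longrightarrow> P (vf_scale k Y)"
  shows "P Y"
proof -
  obtain h where h: "\<forall>b\<in>B. smooth_fun_on A UNIV (h b)" "Y = (\<lambda>p f. \<Sum>b\<in>B. h b p * E b p f)"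
    using assms(1) Y unfolding global_frame_def by blast
  have "(\<lambda>p f. \<Sum>b\<in>B. h b p * E b p f) \<in> vector_fields A \<and> P (\<lambda>p f. \<Sum>b\<in>B. h b p * E b p f)"
    using assms(1) h(1) by (intro frame_combination_induct zero basis add scale)
      (auto simp: global_frame_def)
  with h(2) show ?thesis by simp
qed

context
  fixes D assumes D: "linear_connection A D"
begin

lemma connection_vector_field: "X \<in> vector_fields A \<Longrightarrow> Y \<in> vector_fields A \<Longrightarrow> D X Y \<in> vector_fields A"
  and connection_add_left: "X \<in> vector_fields A \<Longrightarrow> X' \<in> vector_fields A \<Longrightarrow> Y \<in> vector_fields A \<Longrightarrow>
    D (vf_add X X') Y = vf_add (D X Y) (D X' Y)"
  and connection_scale_left: "X \<in> vector_fields A \<Longrightarrow> Y \<in> vector_fields A \<Longrightarrow> smooth_fun_on A UNIV h \<Longrightarrow>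
    D (vf_scale h X) Y = vf_scale h (D X Y)"
  and connection_add_right: "X \<in> vector_fields A \<Longrightarrow> Y \<in> vector_fields A \<Longrightarrow> Y' \<in> vector_fields A \<Longrightarrow>
    D X (vf_add Y Y') = vf_add (D X Y) (D X Y')"
  and connection_scale_right: "X \<in> vector_fields A \<Longrightarrow> Y \<in> vector_fields A \<Longrightarrow> smooth_fun_on A UNIV h \<Longrightarrow>
    D X (vf_scale h Y) = vf_add (vf_scale (\<lambda>p. X p h) Y) (vf_scale h (D X Y))"
  using D unfolding linear_connection_def by blast+

lemma smooth_fun_on_const: "smooth_fun_on A UNIV (\<lambda>p. c)"
  by (simp add: smooth_fun_on_UNIV smooth_near_const)

lemma connection_zero_left: "Y \<in> vector_fields A \<Longrightarrow> D (\<lambda>p f. 0) Y = (\<lambda>p f. 0)"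
  using connection_scale_left[OF zero_vector_field _ smooth_fun_on_const[of 0]]
  by (simp add: vf_scale_def)

lemma connection_zero_right:
  assumes "X \<in> vector_fields A" shows "D X (\<lambda>p f. 0) = (\<lambda>p f. 0)"
  using connection_scale_right[OF assms zero_vector_field smooth_fun_on_const[of 0]]
  by (simp add: vf_scale_def vf_add_def)

end

text \<open>
  The derivative of the coefficient in the Leibniz rule is the same for both connections, so
  their agreement is preserved by multiplication with smooth functions in either argument.
\<close>

lemma connection_eq_if_eq_on_frame:
  assumes D: "linear_connection A D" and D': "linear_connection A D'" and E: "global_frame B E"
    and eq: "\<And>b c. b \<in> B \<Longrightarrow> c \<in> B \<Longrightarrow> D (E b) (E c) = D' (E b) (E c)"
    and X: "X \<in> vector_fields A" and Y: "Y \<in> vector_fields A"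
  shows "D X Y = D' X Y"
proof -
  have E_vf: "E b \<in> vector_fields A" if "b \<in> B" for b
    using E that by (auto simp: global_frame_def)
  have *: "D X (E c) = D' X (E c)" if c: "c \<in> B" for c
    using E X
  proof (rule global_frame_induct)
    show "D (\<lambda>p f. 0) (E c) = D' (\<lambda>p f. 0) (E c)"
      using E_vf[OF c] by (simp add: connection_zero_left[OF D] connection_zero_left[OF D'])
  qed (use c eq E_vf in \<open>simp_all add: connection_add_left[OF D] connection_add_left[OF D']
      connection_scale_left[OF D] connection_scale_left[OF D']\<close>)
  show ?thesis
    using E Y
  proof (rule global_frame_induct)
    show "D X (\<lambda>p f. 0) = D' X (\<lambda>p f. 0)"
      using X by (simp add: connection_zero_right[OF D] connection_zero_right[OF D'])
  qed (use X * in \<open>simp_all add: connection_add_right[OF D] connection_add_right[OF D']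
      connection_scale_right[OF D] connection_scale_right[OF D']\<close>)
qed

lemma torsion_swap: "torsion A D Y X p f = - torsion A D X Y p f"
  by (simp add: torsion_def lie_bracket_antisym[of X Y])

text \<open>
  In the torsion, the derivative of the coefficient in the Leibniz rule cancels against the one
  in the bracket; hence the torsion is linear over the smooth functions in its second argument,
  and by antisymmetry in the first.
\<close>

lemma torsion_zero_if_zero_on_frame:
  assumes D: "linear_connection A D" and E: "global_frame B E"
    and eq: "\<And>b c. b \<in> B \<Longrightarrow> c \<in> B \<Longrightarrow> torsion A D (E b) (E c) = (\<lambda>p f. 0)"
    and X: "X \<in> vector_fields A" and Y: "Y \<in> vector_fields A"
  shows "torsion A D X Y = (\<lambda>p f. 0)"
proof -
  have E_vf: "E b \<in> vector_fields A" if "b \<in> B" for b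
    using E that by (auto simp: global_frame_def)
  have step: "torsion A D Z Y = (\<lambda>p f. 0)"
    if Z: "Z \<in> vector_fields A" and b: "\<And>b. b \<in> B \<Longrightarrow> torsion A D Z (E b) = (\<lambda>p f. 0)"
      and Y: "Y \<in> vector_fields A" for Y Z
    using E Y
  proof (rule global_frame_induct)
    show "torsion A D Z (\<lambda>p f. 0) = (\<lambda>p f. 0)"
      using Z by (simp add: torsion_def lie_bracket_def connection_zero_left[OF D]
          connection_zero_right[OF D] tangent_const[OF vector_field_tangent[OF Z]] fun_eq_iff)
  next
    fix Y Y' assume "Y \<in> vector_fields A" "Y' \<in> vector_fields A"
      "torsion A D Z Y = (\<lambda>p f. 0)" "torsion A D Z Y' = (\<lambda>p f. 0)"
    then show "torsion A D Z (vf_add Y Y') = (\<lambda>p f. 0)"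
      using Z unfolding torsion_def fun_eq_iff
      by (simp only: connection_add_left[OF D] connection_add_right[OF D] lie_bracket_add_right)
        (simp add: vf_add_def add_diff_add)
  next
    fix k Y assume k: "smooth_fun_on A UNIV k" and Y: "Y \<in> vector_fields A" and t: "torsion A D Z Y = (\<lambda>p f. 0)"
    have "torsion A D Z (vf_scale k Y) p f = k p * torsion A D Z Y p f" for p f
      unfolding torsion_def connection_scale_left[OF D Y Z k] connection_scale_right[OF D Z Y k]
        lie_bracket_scale_right[OF k Z Y]
      by (simp add: vf_add_def vf_scale_def algebra_simps)
    with t show "torsion A D Z (vf_scale k Y) = (\<lambda>p f. 0)" by (simp add: fun_eq_iff)
  qed (fact b)
  have "torsion A D X (E c) = (\<lambda>p f. 0)" if c: "c \<in> B" for c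
  proof -
    have "torsion A D (E c) X = (\<lambda>p f. 0)"
      by (rule step[OF E_vf[OF c] _ X]) (rule eq[OF c])
    then show ?thesis using torsion_swap[of D X "E c"] by (simp add: fun_eq_iff)
  qed
  then show ?thesis using step X Y by blast
qed

lemma connection_combination_left:
  assumes D: "linear_connection A D" and "finite B" "\<And>b. b \<in> B \<Longrightarrow> E b \<in> vector_fields A"
    and "\<And>b. b \<in> B \<Longrightarrow> smooth_fun_on A UNIV (h b)" and Y: "Y \<in> vector_fields A"
  shows "D (\<lambda>p f. \<Sum>b\<in>B. h b p * E b p f) Y = (\<lambda>p f. \<Sum>b\<in>B. h b p * D (E b) Y p f)"
proof -
  have "(\<lambda>p f. \<Sum>b\<in>B. h b p * E b p f) \<in> vector_fields A \<and>
      D (\<lambda>p f. \<Sum>b\<in>B. h b p * E b p f) Y = (\<lambda>p f. \<Sum>b\<in>B. h b p * D (E b) Y p f)"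
    using assms(2-4)
  proof (induction B rule: finite_induct)
    case empty
    then show ?case using zero_vector_field connection_zero_left[OF D Y] by simp
  next
    case (insert b B)
    let ?S = "\<lambda>p f. \<Sum>c\<in>B. h c p * E c p f"
    have *: "(\<lambda>p f. \<Sum>c\<in>insert b B. h c p * E c p f) = vf_add (vf_scale (h b) (E b)) ?S"
      using insert.hyps by (simp add: vf_add_def vf_scale_def)
    have S: "?S \<in> vector_fields A" "D ?S Y = (\<lambda>p f. \<Sum>c\<in>B. h c p * D (E c) Y p f)"
      using insert by auto
    have b: "E b \<in> vector_fields A" "smooth_fun_on A UNIV (h b)" using insert.prems by auto
    have hE: "vf_scale (h b) (E b) \<in> vector_fields A" using b by (intro vf_scale_vector_field)
    have "D (vf_add (vf_scale (h b) (E b)) ?S) Y = vf_add (vf_scale (h b) (D (E b) Y)) (D ?S Y)"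
      by (simp only: connection_add_left[OF D hE S(1) Y] connection_scale_left[OF D b(1) Y b(2)])
    also have "\<dots> = (\<lambda>p f. \<Sum>c\<in>insert b B. h c p * D (E c) Y p f)"
      using insert.hyps S(2) by (simp add: vf_add_def vf_scale_def)
    finally show ?case
      unfolding * using vf_add_vector_field[OF hE S(1)] by simp
  qed
  then show ?thesis ..
qed

lemma lie_bracket_combination_right:
  assumes "X \<in> vector_fields A" "\<And>b. b \<in> B \<Longrightarrow> E b \<in> vector_fields A"
    and "\<And>b. b \<in> B \<Longrightarrow> smooth_fun_on A UNIV (h b)"
  shows "lie_bracket A X (\<lambda>p f. \<Sum>b\<in>B. h b p * E b p f) p f =
    (\<Sum>b\<in>B. X p (h b) * E b p f + h b p * lie_bracket A X (E b) p f)"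
proof (cases "smooth_near A p f")
  case True
  have E: "smooth_near A p (\<lambda>q. E b q f)" and h: "smooth_near A p (h b)" if "b \<in> B" for b
    using assms that True by (auto intro: vector_field_smooth_near simp: smooth_fun_on_UNIV)
  note X = vector_field_tangent[OF assms(1), of p]
  have "X p (\<lambda>q. \<Sum>b\<in>B. h b q * E b q f) = (\<Sum>b\<in>B. X p (\<lambda>q. h b q * E b q f))"
    by (intro tangent_sum[OF X] smooth_near_mult E h)
  also have "\<dots> = (\<Sum>b\<in>B. h b p * X p (\<lambda>q. E b q f) + E b p f * X p (h b))"
    using E h by (intro sum.cong refl tangent_mult[OF X])
  finally show ?thesis
    using True by (simp add: lie_bracket_def sum_subtractf sum.distrib right_diff_distrib mult.commute)
next
  case False
  then show ?thesis
    by (simp add: lie_bracket_def tangent_not_smooth[OF vector_field_tangent[OF assms(2)]])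
qed

lemma linear_connection_pullback:
  assumes F: "diffeomorphism A F" and D: "linear_connection A D"
  shows "linear_connection A (\<lambda>X Y. pushforward (inv F) (D (pushforward F X) (pushforward F Y)))"
proof -
  note G = diffeomorphism_inv[OF F]
  note push = pushforward_vector_field[OF F] and pull = pushforward_vector_field[OF G]
  note inv = pushforward_inv[OF F] diffeo_inv[OF F]
  have inv_inv: "inv (inv F) = F" using F by (simp add: diffeomorphism_def inv_inv_eq)
  have h: "smooth_fun_on A UNIV (\<lambda>p. h (inv F p))" if "smooth_fun_on A UNIV h" for h
    using that by (simp add: smooth_fun_on_UNIV smooth_near_diffeomorphism[OF G])
  have "pushforward (inv F) (D (pushforward F X) (pushforward F Y)) \<in> vector_fields A"
    if "X \<in> vector_fields A" "Y \<in> vector_fields A" for X Y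
    using that by (intro pull connection_vector_field[OF D] push)
  moreover have "pushforward (inv F) (D (pushforward F (vf_scale h X)) (pushforward F Y)) =
      vf_scale h (pushforward (inv F) (D (pushforward F X) (pushforward F Y)))"
    if "X \<in> vector_fields A" "Y \<in> vector_fields A" "smooth_fun_on A UNIV h" for X Y h
    using that by (simp add: pushforward_scale[OF F] connection_scale_left[OF D] push h
        pushforward_scale[OF G] inv_inv inv)
  moreover have "pushforward (inv F) (D (pushforward F X) (pushforward F (vf_scale h Y))) =
      vf_add (vf_scale (\<lambda>p. X p h) Y) (vf_scale h (pushforward (inv F) (D (pushforward F X) (pushforward F Y))))"
    if "X \<in> vector_fields A" "Y \<in> vector_fields A" "smooth_fun_on A UNIV h" for X Y h
    using that by (simp add: pushforward_scale[OF F] connection_scale_right[OF D] push h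
        pushforward_add[OF G] pushforward_scale[OF G] inv_inv inv pushforward_apply[OF F])
  ultimately show ?thesis
    unfolding linear_connection_def
    by (simp add: pushforward_add[OF F] pushforward_add[OF G] connection_add_left[OF D]
        connection_add_right[OF D] push)
qed

end


section \<open>Lie groups\<close>

locale lie_group_locale =
  fixes A :: "('g::{t2_space,second_countable_topology}, 'e::{real_inner,banach}) atlas"
    and mul :: "'g \<Rightarrow> 'g \<Rightarrow> 'g" and e :: 'g and i :: "'g \<Rightarrow> 'g"
  assumes lie_group: "lie_group A mul e i"
begin

sublocale manifold A
  using lie_group by unfold_locales (simp add: lie_group_def)

lemma group: "group mul e i"
  using lie_group by (simp add: lie_group_def)

lemma mul_assoc: "mul (mul a b) c = mul a (mul b c)"
proof -
  interpret g: Groups.group mul e i by (rule group)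
  show ?thesis by (rule g.assoc)
qed

lemma group_laws [simp]:
  "mul e a = a" "mul a e = a" "mul (i a) a = e" "mul a (i a) = e"
  "mul (i a) (mul a b) = b" "mul a (mul (i a) b) = b"
  "i (i a) = a"
proof -
  interpret g: Groups.group mul e i by (rule group)
  show 1: "mul e a = a" "mul a e = a" "mul (i a) a = e" "mul a (i a) = e" for a
    by (simp_all add: g.group_left_neutral)
  show 2: "mul (i a) (mul a b) = b" "mul a (mul (i a) b) = b" for a
    by (simp_all add: mul_assoc[symmetric] 1)
  have "mul (i (i a)) (mul (i a) a) = a" for a
    by (simp add: mul_assoc[symmetric] 1)
  then show "i (i a) = a" by (simp add: 1)
qed

lemma is_manifold: "manifold A" by unfold_locales

lemma is_manifold_product: "manifold (product_atlas A A)"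
  by (intro manifold_product is_manifold)

lemma smooth_mul:
  assumes "manifold A'" "smooth_map A' A F" "smooth_map A' A G"
  shows "smooth_map A' A (\<lambda>p. mul (F p) (G p))"
proof -
  have "smooth_map (product_atlas A A) A (\<lambda>(g, h). mul g h)"
    using lie_group by (simp add: lie_group_def)
  from smooth_map_comp[OF assms(1) is_manifold_product is_manifold
      smooth_map_Pair[OF assms(1) is_manifold is_manifold assms(2,3)] this]
  show ?thesis by simp
qed

lemma smooth_inverse: "smooth_map A A i"
  using lie_group by (simp add: lie_group_def)

text \<open>
  Left translations and left-invariant fields of the opposite group are the right translations
  and right-invariant fields of the given one, so each result below has a right-handed version.
\<close>

lemma opposite_lie_group: "lie_group A (\<lambda>g h. mul h g) e i"
proof -
  have "group (\<lambda>g h. mul h g) e i"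
    by unfold_locales (simp_all add: mul_assoc)
  moreover have "smooth_map (product_atlas A A) A (\<lambda>z. mul (snd z) (fst z))"
    by (intro smooth_mul is_manifold_product smooth_map_fst smooth_map_snd is_manifold)
  ultimately show ?thesis
    using lie_group unfolding lie_group_def case_prod_beta by blast
qed

lemma inv_left_translation: "bij (mul g)" "inv (mul g) = mul (i g)"
proof -
  show "bij (mul g)" by (rule bij_betw_byWitness[of _ "mul (i g)"]) auto
  show "inv (mul g) = mul (i g)" by (rule inv_unique_comp) (auto simp: fun_eq_iff)
qed

lemma diffeomorphism_left_translation: "diffeomorphism A (mul g)"
proof -
  have "smooth_map A A (mul g)" for g
    using smooth_mul[OF is_manifold smooth_map_const[OF is_manifold] smooth_map_ident[OF is_manifold]] .
  then show ?thesis by (simp add: diffeomorphism_def inv_left_translation)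
qed

lemma smooth_near_left_translation: "smooth_near A p (\<lambda>q. f (mul g q)) \<longleftrightarrow> smooth_near A (mul g p) f"
  by (rule smooth_near_diffeomorphism[OF diffeomorphism_left_translation])

text \<open>
  The left-invariant extension of a tangent vector at \<open>e\<close>: its value at \<open>p\<close> is the image of \<open>v\<close> under
  left translation by \<open>p\<close>.
\<close>

definition left_field :: "(('g \<Rightarrow> real) \<Rightarrow> real) \<Rightarrow> 'g vfield" where
  "left_field v p f = v (\<lambda>q. f (mul p q))"

lemma left_field_vector_field:
  assumes v: "v \<in> tangent_space A e"
  shows "left_field v \<in> vector_fields A"
proof (rule vector_fieldI)
  show "left_field v p \<in> tangent_space A p" for p
    using tangent_image[OF diffeomorphism_left_translation[of p], of v p] v
    by (simp add: inv_left_translation left_field_def[abs_def])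
  fix p f assume f: "smooth_near A p f"
  have "smooth_map (product_atlas A A) A (\<lambda>z. mul (fst z) (snd z))"
    by (intro smooth_mul is_manifold_product smooth_map_fst smooth_map_snd is_manifold)
  from smooth_map_pullback[OF is_manifold_product is_manifold this, of "(p, e)" f]
  have K: "smooth_near (product_atlas A A) (p, e) (\<lambda>z. f (mul (fst z) (snd z)))"
    using f by simp
  have "smooth_near A p (\<lambda>p. v (\<lambda>q. f (mul (fst (p, q)) (snd (p, q)))))"
    by (rule smooth_near_vector_field_along[OF is_manifold is_manifold smooth_map_const[OF is_manifold] v _ K])
      (rule smooth_near_const)
  then show "smooth_near A p (\<lambda>q. left_field v q f)"
    by (simp add: left_field_def)
qed

lemma left_field_left_invariant:
  "v \<in> tangent_space A e \<Longrightarrow> left_field v \<in> left_invariant_vf A mul"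
  by (auto simp: left_invariant_vf_def left_field_vector_field fun_eq_iff pushforward_def
      inv_left_translation left_field_def mul_assoc[symmetric])

lemma left_invariant_vf_vector_field: "X \<in> left_invariant_vf A mul \<Longrightarrow> X \<in> vector_fields A"
  by (simp add: left_invariant_vf_def)

lemma left_invariant_vf_apply:
  assumes "X \<in> left_invariant_vf A mul"
  shows "X p f = X e (\<lambda>q. f (mul p q))"
proof -
  have "X p f = pushforward (mul p) X p f" using assms by (simp add: left_invariant_vf_def)
  also have "\<dots> = X e (\<lambda>q. f (mul p q))" by (simp add: pushforward_def inv_left_translation comp_def)
  finally show ?thesis .
qed

text \<open>
  The frame extends the coordinate directions at \<open>e\<close>.  The coefficients of \<open>Y\<close> at \<open>p\<close> are the
  coordinates of the vector at \<open>e\<close> to which the translation by the inverse of \<open>p\<close> moves \<open>Y p\<close>; that is,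
  \<open>Y p\<close> is applied to the coordinates of \<open>mul (i p) q\<close> as functions of \<open>q\<close>.
\<close>

lemma left_invariant_frame:
  obtains B :: "'e set" and E where "global_frame B E" "\<And>b. b \<in> B \<Longrightarrow> E b \<in> left_invariant_vf A mul"
proof -
  obtain U \<phi> where U: "(U, \<phi>) \<in> A" "e \<in> U" by (rule chart_at)
  obtain B :: "'e set" where B: "resolves_identity B" by (rule resolution)
  define E where "E b = left_field (coordinate_vector U \<phi> e b)" for b
  have E: "E b \<in> left_invariant_vf A mul" for b
    unfolding E_def by (intro left_field_left_invariant coordinate_vector_tangent U)
  have "\<exists>h. (\<forall>b\<in>B. smooth_fun_on A UNIV (h b)) \<and> Y = (\<lambda>p f. \<Sum>b\<in>B. h b p * E b p f)"
    if Y: "Y \<in> vector_fields A" for Y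
  proof (intro exI conjI ballI)
    let ?h = "\<lambda>b p. Y p (\<lambda>q. \<phi> (mul (i p) q) \<bullet> b)"
    have "smooth_map (product_atlas A A) A (\<lambda>z. mul (i (fst z)) (snd z))"
      by (intro smooth_mul is_manifold_product smooth_map_snd is_manifold
          smooth_map_comp[OF is_manifold_product is_manifold is_manifold _ smooth_inverse] smooth_map_fst)
    from smooth_map_pullback[OF is_manifold_product is_manifold this, of "(p, p)" "\<lambda>q. \<phi> q \<bullet> b" for p b]
    have K: "smooth_near (product_atlas A A) (p, p) (\<lambda>z. \<phi> (mul (i (fst z)) (snd z)) \<bullet> b)" for b p
      using smooth_near_coordinate[OF U, of b] by simp
    have "smooth_near A p (\<lambda>p. Y p (\<lambda>q. \<phi> (mul (i (fst (p, q))) (snd (p, q))) \<bullet> b))" for b p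
      by (rule smooth_near_vector_field_along[OF is_manifold is_manifold smooth_map_ident[OF is_manifold]
            vector_field_tangent[OF Y] vector_field_smooth_near[OF Y] K])
    then show "smooth_fun_on A UNIV (?h b)" for b
      by (simp add: smooth_fun_on_UNIV)
    show "Y = (\<lambda>p f. \<Sum>b\<in>B. ?h b p * E b p f)"
    proof (intro ext)
      fix p f
      define v where "v f = Y p (\<lambda>q. f (mul (i p) q))" for f
      have v: "v \<in> tangent_space A e"
        using tangent_image[OF diffeomorphism_left_translation[of "i p"], of "Y p" e]
          vector_field_tangent[OF Y, of p] diffeomorphism_left_translation[of p]
        by (simp add: inv_left_translation v_def[abs_def])
      have vf: "Y p f = v (\<lambda>q. f (mul p q))"
        by (simp add: v_def)
      show "Y p f = (\<Sum>b\<in>B. ?h b p * E b p f)"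
      proof (cases "smooth_near A p f")
        case True
        then have n: "smooth_near A e (\<lambda>q. f (mul p q))"
          by (simp add: smooth_near_left_translation)
        show ?thesis
          unfolding vf tangent_eq_directional_derivative(2)[OF v B U n]
          by (simp add: E_def left_field_def coordinate_vector_def n v_def)
      next
        case False
        then show ?thesis
          using Y left_invariant_vf_vector_field[OF E]
          by (simp add: tangent_not_smooth[OF vector_field_tangent])
      qed
    qed
  qed
  then have "global_frame B E"
    using B E left_invariant_vf_vector_field by (auto simp: global_frame_def resolves_identity_def)
  with E show thesis by (intro that)
qed

text \<open>
  At \<open>p\<close>, both \<open>X (R f)\<close> and \<open>R (X f)\<close> are obtained from the function \<open>f (s p q)\<close> of \<open>(s, q)\<close>: the
  field \<open>X\<close> differentiates it in \<open>q\<close> and \<open>R\<close> in \<open>s\<close>, each at \<open>e\<close>.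
\<close>

lemma lie_bracket_left_right_invariant:
  assumes X: "X \<in> left_invariant_vf A mul" and R: "R \<in> right_invariant_vf A mul"
  shows "lie_bracket A X R = (\<lambda>p f. 0)"
proof (intro ext)
  interpret op: lie_group_locale A "\<lambda>g h. mul h g" e i
    by unfold_locales (rule opposite_lie_group)
  have R': "R \<in> left_invariant_vf A (\<lambda>g h. mul h g)"
    using R by (simp add: left_invariant_vf_def right_invariant_vf_def)
  note x = left_invariant_vf_apply[OF X] and r = op.left_invariant_vf_apply[OF R']
  fix p f
  show "lie_bracket A X R p f = 0"
  proof (cases "smooth_near A p f")
    case True
    have "smooth_map (product_atlas A A) A (\<lambda>z. mul (fst z) (mul p (snd z)))"
      by (intro smooth_mul is_manifold_product smooth_map_fst smooth_map_snd is_manifold smooth_map_const)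
    from smooth_map_pullback[OF is_manifold_product is_manifold this, of "(e, e)" f]
    have K: "smooth_near (product_atlas A A) (e, e) (\<lambda>z. f (mul (fst z) (mul p (snd z))))"
      using True by simp
    have "X p (\<lambda>q. R q f) = X e (\<lambda>q. R e (\<lambda>s. f (mul s (mul p q))))"
      unfolding x[of p "\<lambda>q. R q f"] r[of "mul p q" f for q] by simp
    also have "\<dots> = R e (\<lambda>s. X e (\<lambda>q. f (mul s (mul p q))))"
      using tangent_vectors_commute[OF is_manifold is_manifold
          vector_field_tangent[OF op.left_invariant_vf_vector_field[OF R']]
          vector_field_tangent[OF left_invariant_vf_vector_field[OF X]] K] by simp
    also have "\<dots> = R p (\<lambda>q. X q f)"
      unfolding r[of p "\<lambda>q. X q f"] x[of "mul s p" f for s] by (simp add: mul_assoc)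
    finally show ?thesis by (simp add: lie_bracket_def True)
  qed (simp add: lie_bracket_def)
qed


section \<open>The connection given by half the bracket\<close>

context
  fixes D
  assumes D: "linear_connection A D"
    and half: "\<forall>X\<in>left_invariant_vf A mul. \<forall>Y\<in>left_invariant_vf A mul.
      D X Y = vf_scale (\<lambda>_. 1/2) (lie_bracket A X Y)"
begin

lemma half_bracket_symmetric: "symmetric_connection A D"
  unfolding symmetric_connection_def
proof (intro ballI)
  obtain B :: "'e set" and E where E: "global_frame B E" "\<And>b. b \<in> B \<Longrightarrow> E b \<in> left_invariant_vf A mul"
    using left_invariant_frame by blast
  have frame: "torsion A D (E b) (E c) = (\<lambda>p f. 0)" if "b \<in> B" "c \<in> B" for b c
  proof -
    have "D (E b) (E c) = vf_scale (\<lambda>_. 1/2) (lie_bracket A (E b) (E c))"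
      "D (E c) (E b) = vf_scale (\<lambda>_. 1/2) (lie_bracket A (E c) (E b))"
      using half E(2) that by simp_all
    then show ?thesis
      by (simp add: torsion_def vf_scale_def lie_bracket_antisym[of "E b" "E c"] fun_eq_iff)
  qed
  fix X Y assume "X \<in> vector_fields A" "Y \<in> vector_fields A"
  then show "torsion A D X Y = (\<lambda>p f. 0)"
    by (intro torsion_zero_if_zero_on_frame[OF D E(1) frame])
qed

text \<open>
  Transport along a left translation fixes left-invariant fields and their brackets.  Hence it
  yields a connection that agrees with \<open>D\<close> on a frame.
\<close>

lemma half_bracket_left_invariant: "affine_transformation A D (mul g)"
  unfolding affine_transformation_def
proof (intro conjI ballI)
  note F = diffeomorphism_left_translation[of g]
  show "diffeomorphism A (mul g)" by (rule F)
  fix X Y assume X: "X \<in> vector_fields A" and Y: "Y \<in> vector_fields A"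
  obtain B :: "'e set" and E where E: "global_frame B E" "\<And>b. b \<in> B \<Longrightarrow> E b \<in> left_invariant_vf A mul"
    using left_invariant_frame by blast
  have push: "pushforward (mul g) (E b) = E b" "pushforward (inv (mul g)) (E b) = E b" if "b \<in> B" for b
  proof -
    show 1: "pushforward (mul g) (E b) = E b" using E(2)[OF that] by (simp add: left_invariant_vf_def)
    show "pushforward (inv (mul g)) (E b) = E b" using pushforward_inv[OF F, of "E b"] by (simp add: 1)
  qed
  have frame: "pushforward (inv (mul g)) (D (pushforward (mul g) (E b)) (pushforward (mul g) (E c))) = D (E b) (E c)"
    if "b \<in> B" "c \<in> B" for b c
    using half E(2) that
    by (simp add: push pushforward_scale[OF diffeomorphism_inv[OF F]]
        pushforward_lie_bracket[OF diffeomorphism_inv[OF F]])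
  have "pushforward (inv (mul g)) (D (pushforward (mul g) X) (pushforward (mul g) Y)) = D X Y"
    by (rule connection_eq_if_eq_on_frame[OF linear_connection_pullback[OF F D] D E(1) _ X Y])
      (rule frame)
  then show "pushforward (mul g) (D X Y) = D (pushforward (mul g) X) (pushforward (mul g) Y)"
    using pushforward_inv'[OF F] by metis
qed

text \<open>
  With \<open>R = \<Sum>\<^sub>b a\<^sub>b E\<^sub>b\<close> and \<open>M(Y) = \<Sum>\<^sub>b Y(a\<^sub>b) E\<^sub>b\<close>, the identity \<open>D R Y - [R, Y] = 1/2 M(Y)\<close> holds on the
  left-invariant frame because \<open>R\<close> commutes with it, and extends to all \<open>Y\<close> as both sides are linear
  over the smooth functions.  For right-invariant \<open>S\<close> it gives the claim since \<open>M(S) = [S, R]\<close>.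
\<close>

lemma half_bracket_right_invariant_fields:
  assumes R: "R \<in> right_invariant_vf A mul" and S: "S \<in> right_invariant_vf A mul"
  shows "D R S = vf_scale (\<lambda>_. 1/2) (lie_bracket A R S)"
proof -
  obtain B :: "'e set" and E where E: "global_frame B E" "\<And>b. b \<in> B \<Longrightarrow> E b \<in> left_invariant_vf A mul"
    using left_invariant_frame by blast
  have fin: "finite B" and E_vf: "\<And>b. b \<in> B \<Longrightarrow> E b \<in> vector_fields A"
    using E(1) by (auto simp: global_frame_def)
  have R_vf: "R \<in> vector_fields A" and S_vf: "S \<in> vector_fields A"
    using R S by (auto simp: right_invariant_vf_def)
  obtain a where a: "\<And>b. b \<in> B \<Longrightarrow> smooth_fun_on A UNIV (a b)" and R_eq: "R = (\<lambda>p f. \<Sum>b\<in>B. a b p * E b p f)"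
    using E(1) R_vf unfolding global_frame_def by blast
  have bracket_R: "lie_bracket A X R p f = (\<Sum>b\<in>B. X p (a b) * E b p f + a b p * lie_bracket A X (E b) p f)"
    if "X \<in> vector_fields A" for X p f
    unfolding R_eq by (rule lie_bracket_combination_right[OF that E_vf a])
  have ER: "lie_bracket A (E b) R = (\<lambda>p f. 0)" and RE: "lie_bracket A R (E b) = (\<lambda>p f. 0)"
    and SE: "lie_bracket A S (E b) = (\<lambda>p f. 0)" if "b \<in> B" for b
    using lie_bracket_left_right_invariant[OF E(2)[OF that] R] lie_bracket_left_right_invariant[OF E(2)[OF that] S]
    by (auto simp: fun_eq_iff lie_bracket_antisym[of R "E b"] lie_bracket_antisym[of S "E b"])
  let ?M = "\<lambda>Y p f. \<Sum>b\<in>B. Y p (a b) * E b p f"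
  have "\<forall>p f. D R Y p f - lie_bracket A R Y p f = 1/2 * ?M Y p f" if "Y \<in> vector_fields A" for Y
    using E(1) that
  proof (rule global_frame_induct)
    show "\<forall>p f. D R (\<lambda>p f. 0) p f - lie_bracket A R (\<lambda>p f. 0) p f = 1/2 * ?M (\<lambda>p f. 0) p f"
      using R_vf by (simp add: connection_zero_right[OF D] lie_bracket_def
          tangent_const[OF vector_field_tangent[OF R_vf]])
  next
    fix b assume b: "b \<in> B"
    show "\<forall>p f. D R (E b) p f - lie_bracket A R (E b) p f = 1/2 * ?M (E b) p f"
    proof (intro allI)
      fix p f
      have "D R (E b) p f = (\<Sum>c\<in>B. a c p * D (E c) (E b) p f)"
        unfolding R_eq by (simp add: connection_combination_left[OF D fin E_vf a E_vf[OF b]])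
      also have "\<dots> = (\<Sum>c\<in>B. - (1/2 * (a c p * lie_bracket A (E b) (E c) p f)))"
        using half E(2) b
        by (intro sum.cong refl) (simp add: vf_scale_def lie_bracket_antisym[of "E _" "E b"])
      also have "\<dots> = - (1/2 * (\<Sum>c\<in>B. a c p * lie_bracket A (E b) (E c) p f))"
        by (simp add: sum_negf sum_distrib_left)
      also have "\<dots> = 1/2 * ?M (E b) p f"
        using bracket_R[OF E_vf[OF b], of p f] ER[OF b] by (simp add: sum.distrib)
      finally show "D R (E b) p f - lie_bracket A R (E b) p f = 1/2 * ?M (E b) p f"
        using RE[OF b] by simp
    qed
  next
    fix Y Y' assume "Y \<in> vector_fields A" "Y' \<in> vector_fields A"
      "\<forall>p f. D R Y p f - lie_bracket A R Y p f = 1/2 * ?M Y p f"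
      "\<forall>p f. D R Y' p f - lie_bracket A R Y' p f = 1/2 * ?M Y' p f"
    then show "\<forall>p f. D R (vf_add Y Y') p f - lie_bracket A R (vf_add Y Y') p f = 1/2 * ?M (vf_add Y Y') p f"
      using R_vf by (simp only: connection_add_right[OF D] lie_bracket_add_right)
        (simp add: vf_add_def add_diff_add distrib_right sum.distrib)
  next
    fix k Y assume "smooth_fun_on A UNIV k" "Y \<in> vector_fields A"
      "\<forall>p f. D R Y p f - lie_bracket A R Y p f = 1/2 * ?M Y p f"
    then show "\<forall>p f. D R (vf_scale k Y) p f - lie_bracket A R (vf_scale k Y) p f = 1/2 * ?M (vf_scale k Y) p f"
      using R_vf by (simp only: connection_scale_right[OF D] lie_bracket_scale_right)
        (simp add: vf_add_def vf_scale_def right_diff_distrib[symmetric] sum_distrib_left mult.assoc)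
  qed
  from this[OF S_vf] have "D R S p f - lie_bracket A R S p f = 1/2 * ?M S p f" for p f
    by blast
  moreover have "lie_bracket A S R p f = ?M S p f" for p f
    using bracket_R[OF S_vf, of p f] SE by simp
  ultimately have "D R S p f = 1/2 * lie_bracket A R S p f" for p f
    using lie_bracket_antisym[of S R p f] by (simp add: diff_eq_eq)
  then show ?thesis by (intro ext) (simp add: vf_scale_def)
qed

end

end

theorem proposition2p1:
  fixes A :: "('g::{t2_space,second_countable_topology}, 'e::{real_inner,banach}) atlas"
    and mul :: "'g \<Rightarrow> 'g \<Rightarrow> 'g" and e :: 'g and i :: "'g \<Rightarrow> 'g"
    and D :: "'g vfield \<Rightarrow> 'g vfield \<Rightarrow> 'g vfield"
  assumes "lie_group A mul e i"
    and "linear_connection A D"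
    and "\<forall>X\<in>left_invariant_vf A mul. \<forall>Y\<in>left_invariant_vf A mul.
           D X Y = vf_scale (\<lambda>_. 1/2) (lie_bracket A X Y)"
  shows "(\<forall>X\<in>right_invariant_vf A mul. \<forall>Y\<in>right_invariant_vf A mul.
            D X Y = vf_scale (\<lambda>_. 1/2) (lie_bracket A X Y)) \<and>
         (\<forall>D'. linear_connection A D' \<and>
            (\<forall>X\<in>right_invariant_vf A mul. \<forall>Y\<in>right_invariant_vf A mul.
               D' X Y = vf_scale (\<lambda>_. 1/2) (lie_bracket A X Y)) \<longrightarrow>
            (\<forall>X\<in>vector_fields A. \<forall>Y\<in>vector_fields A. D' X Y = D X Y)) \<and>
         right_invariant_connection A mul D \<and>
         bi_invariant_connection A mul D \<and>
         symmetric_connection A D"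
proof -
  interpret lie_group_locale A mul e i by unfold_locales fact
  interpret op: lie_group_locale A "\<lambda>g h. mul h g" e i
    by unfold_locales (rule opposite_lie_group)
  note D = assms(2) and half = assms(3)
  have right: "right_invariant_vf A mul = left_invariant_vf A (\<lambda>g h. mul h g)"
    by (simp add: right_invariant_vf_def left_invariant_vf_def)
  \<comment> \<open>From here on the hypothesis holds for the opposite group as well.\<close>
  have half_right: "\<forall>X\<in>right_invariant_vf A mul. \<forall>Y\<in>right_invariant_vf A mul.
      D X Y = vf_scale (\<lambda>_. 1/2) (lie_bracket A X Y)"
    using half_bracket_right_invariant_fields[OF D half] by blast
  have unique: "D' X Y = D X Y"
    if D': "linear_connection A D'" and half': "\<forall>X\<in>right_invariant_vf A mul. \<forall>Y\<in>right_invariant_vf A mul.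
      D' X Y = vf_scale (\<lambda>_. 1/2) (lie_bracket A X Y)" and XY: "X \<in> vector_fields A" "Y \<in> vector_fields A"
    for D' X Y
  proof -
    obtain B :: "'e set" and E where E: "global_frame B E" "\<And>b. b \<in> B \<Longrightarrow> E b \<in> right_invariant_vf A mul"
      using op.left_invariant_frame unfolding right by blast
    then show ?thesis
      using half' half_right by (intro connection_eq_if_eq_on_frame[OF D' D E(1) _ XY]) simp
  qed
  have "left_invariant_connection A mul D"
    unfolding left_invariant_connection_def using half_bracket_left_invariant[OF D half] by blast
  moreover have "right_invariant_connection A mul D"
    unfolding right_invariant_connection_def
    using op.half_bracket_left_invariant[OF D half_right[unfolded right]] by blast
  ultimately show ?thesis
    using half_right unique half_bracket_symmetric[OF D half]
    by (auto simp: bi_invariant_connection_def)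
qed

end
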